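(* Let $\mathcal{H}_A,\mathcal{H}_B$ be finite-dimensional complex Hilbert spaces, $d_A=\dim\mathcal{H}_A$, and let $\rho_{AB}$ be a density operator on $\mathcal{H}_A\otimes\mathcal{H}_B$. Let $\mathcal{H}_{A'}\cong\mathcal{H}_A$, with orthonormal bases $\{|x\rangle_A\}_{x=1}^{d_A}$ of $\mathcal{H}_A$ and $\{|x\rangle_{A'}\}_{x=1}^{d_A}$ of $\mathcal{H}_{A'}$, and let $$|\Phi_{AA'}\rangle=\frac{1}{\sqrt{d_A}}\sum_{x=1}^{d_A}|x\rangle_A\otimes|x\rangle_{A'} .$$ Then $$H_{\min}(A|B)_\rho=-\log_2 q_{\mathsf{corr}}(A|B)_\rho ,$$ where $$q_{\mathsf{corr}}(A|B)_\rho:=d_A\max_{\mathcal{F}}F\bigl((\mathrm{id}_A\otimes\mathcal{F})(\rho_{AB}),\,|\Phi_{AA'}\rangle\langle\Phi_{AA'}|\bigr)^2,$$ the maximum being taken over all quantum operations (completely positive trace-preserving linear maps) $\mathcal{F}:\mathcal{L}(\mathcal{H}_B)\to\mathcal{L}(\mathcal{H}_{A'})$.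
   Context: A density operator is a nonnegative (positive semidefinite) operator of trace one. $\mathcal{L}(\mathcal{H})$ is the set of linear maps $\mathcal{H}\to\mathcal{H}$. $\mathrm{id}_A$ denotes the identity operator on $\mathcal{H}_A$, or, in $\mathrm{id}_A\otimes\mathcal{F}$, the identity map on $\mathcal{L}(\mathcal{H}_A)$. The fidelity is $F(\rho,\sigma)=\|\sqrt{\rho}\sqrt{\sigma}\|_1$ (trace norm). For nonnegative operators $\tau,\tau'$ define $D_\infty(\tau\|\tau'):=\inf\{\lambda\in\mathbb{R}:\ \tau\le 2^\lambda\tau'\}$, where $\le$ is the order on Hermitian operators and $\inf\emptyset=+\infty$. The conditional min-entropy is $$H_{\min}(A|B)_\rho:=-\inf_{\sigma_B}D_\infty(\rho_{AB}\|\mathrm{id}_A\otimes\sigma_B),$$ where the infimum ranges over all (normalized) density operators $\sigma_B$ on $\mathcal{H}_B$. *)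

theory Defs
  imports "HOL-Analysis.Analysis"
begin

text \<open>
  A complex Hilbert space of dimension \<open>CARD('n)\<close> is modelled by \<open>complex ^ 'n\<close>, its operators by
  square matrices, and the tensor product of \<open>complex ^ 'm\<close> and \<open>complex ^ 'n\<close> by
  \<open>complex ^ ('m \<times> 'n)\<close>.
\<close>

subsection \<open>Vectors and operators\<close>

text \<open>Antilinear in the first argument. The inner product of the class \<open>real_inner\<close> on
  \<open>complex ^ 'n\<close> is only the real part of this one.\<close>

definition cinner :: "complex ^ 'n::finite \<Rightarrow> complex ^ 'n \<Rightarrow> complex"
  where "cinner v w = (\<Sum>i\<in>UNIV. cnj (v $ i) * w $ i)"

definition orthonormal_basis :: "(nat \<Rightarrow> complex ^ 'n::finite) \<Rightarrow> bool"
  where "orthonormal_basis e \<longleftrightarrow>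
    (\<forall>x\<in>{1..CARD('n)}. \<forall>y\<in>{1..CARD('n)}. cinner (e x) (e y) = (if x = y then 1 else 0)) \<and>
    vec.span (e ` {1..CARD('n)}) = UNIV"

definition cadjoint :: "complex ^ 'n ^ 'm \<Rightarrow> complex ^ 'm ^ 'n"
  where "cadjoint A = (\<chi> i j. cnj (A $ j $ i))"

definition cscale :: "complex \<Rightarrow> complex ^ 'n ^ 'm \<Rightarrow> complex ^ 'n ^ 'm"
  where "cscale c A = (\<chi> i j. c * A $ i $ j)"

definition ket_bra :: "complex ^ 'n \<Rightarrow> complex ^ 'n ^ 'n"
  where "ket_bra v = (\<chi> i j. v $ i * cnj (v $ j))"

text \<open>Over the complex numbers, the condition that all \<open>cinner v (A *v v)\<close> are real and nonnegative
  includes that \<open>A\<close> is Hermitian.\<close>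

definition psd :: "complex ^ 'n::finite ^ 'n \<Rightarrow> bool"
  where "psd A \<longleftrightarrow> (\<forall>v. cinner v (A *v v) \<in> \<real>\<^sub>\<ge>\<^sub>0)"

definition loewner_le :: "complex ^ 'n::finite ^ 'n \<Rightarrow> complex ^ 'n ^ 'n \<Rightarrow> bool"
  where "loewner_le A B \<longleftrightarrow> psd (B - A)"

definition density_operator :: "complex ^ 'n::finite ^ 'n \<Rightarrow> bool"
  where "density_operator \<rho> \<longleftrightarrow> psd \<rho> \<and> trace \<rho> = 1"

text \<open>Meaningful for \<open>psd A\<close>, where the nonnegative square root exists and is unique.\<close>

definition psd_sqrt :: "complex ^ 'n::finite ^ 'n \<Rightarrow> complex ^ 'n ^ 'n"
  where "psd_sqrt A = (THE S. psd S \<and> S ** S = A)"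

definition trace_norm :: "complex ^ 'n::finite ^ 'n \<Rightarrow> real"
  where "trace_norm A = Re (trace (psd_sqrt (cadjoint A ** A)))"

definition fidelity :: "complex ^ 'n::finite ^ 'n \<Rightarrow> complex ^ 'n ^ 'n \<Rightarrow> real"
  where "fidelity \<rho> \<sigma> = trace_norm (psd_sqrt \<rho> ** psd_sqrt \<sigma>)"


subsection \<open>Tensor products\<close>

definition tensor_vec :: "complex ^ 'm \<Rightarrow> complex ^ 'n \<Rightarrow> complex ^ ('m::finite \<times> 'n::finite)"
  where "tensor_vec v w = (\<chi> p. v $ fst p * w $ snd p)"

definition tensor_op ::
    "complex ^ 'm ^ 'm \<Rightarrow> complex ^ 'n ^ 'n \<Rightarrow> complex ^ ('m::finite \<times> 'n::finite) ^ ('m \<times> 'n)"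
  where "tensor_op A B = (\<chi> p q. A $ fst p $ fst q * B $ snd p $ snd q)"

text \<open>An operator on a tensor product is a block matrix whose blocks are operators on the second
  factor; \<open>id_tensor F\<close> applies the map \<open>F\<close> to every block.\<close>

definition block :: "complex ^ ('m::finite \<times> 'n::finite) ^ ('m \<times> 'n) \<Rightarrow> 'm \<Rightarrow> 'm \<Rightarrow> complex ^ 'n ^ 'n"
  where "block X i k = (\<chi> j l. X $ (i, j) $ (k, l))"

definition id_tensor :: "(complex ^ 'n ^ 'n \<Rightarrow> complex ^ 'k ^ 'k) \<Rightarrow>
    complex ^ ('m::finite \<times> 'n::finite) ^ ('m \<times> 'n) \<Rightarrow> complex ^ ('m \<times> 'k::finite) ^ ('m \<times> 'k)"
  where "id_tensor F X = (\<chi> p q. F (block X (fst p) (fst q)) $ snd p $ snd q)"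


subsection \<open>Quantum operations\<close>

text \<open>Complete positivity quantifies over reference systems of every finite dimension \<open>r\<close>, which
  cannot be index types inside a formula. An operator on the tensor product of the
  \<open>r\<close>-dimensional space with \<open>complex ^ 'n\<close> is therefore given by its blocks \<open>X i k\<close>, \<open>i, k < r\<close>,
  and a vector by its components \<open>v i\<close>, \<open>i < r\<close>; \<open>block_psd r X\<close> is nonnegativity of that operator.\<close>

definition block_psd :: "nat \<Rightarrow> (nat \<Rightarrow> nat \<Rightarrow> complex ^ 'n::finite ^ 'n) \<Rightarrow> bool"
  where "block_psd r X \<longleftrightarrow>
    (\<forall>v :: nat \<Rightarrow> complex ^ 'n. (\<Sum>i<r. \<Sum>k<r. cinner (v i) (X i k *v v k)) \<in> \<real>\<^sub>\<ge>\<^sub>0)"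

definition completely_positive ::
    "(complex ^ 'n::finite ^ 'n \<Rightarrow> complex ^ 'k::finite ^ 'k) \<Rightarrow> bool"
  where "completely_positive F \<longleftrightarrow>
    (\<forall>r X. block_psd r X \<longrightarrow> block_psd r (\<lambda>i k. F (X i k)))"

definition trace_preserving ::
    "(complex ^ 'n::finite ^ 'n \<Rightarrow> complex ^ 'k::finite ^ 'k) \<Rightarrow> bool"
  where "trace_preserving F \<longleftrightarrow> (\<forall>X. trace (F X) = trace X)"

definition quantum_operation ::
    "(complex ^ 'n::finite ^ 'n \<Rightarrow> complex ^ 'k::finite ^ 'k) \<Rightarrow> bool"
  where "quantum_operation F \<longleftrightarrow>
    Vector_Spaces.linear cscale cscale F \<and> completely_positive F \<and> trace_preserving F"


subsection \<open>Min-entropy and quantum correlation\<close>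

definition D_infinity :: "complex ^ 'n::finite ^ 'n \<Rightarrow> complex ^ 'n ^ 'n \<Rightarrow> ereal"
  where "D_infinity \<tau> \<tau>' = Inf {ereal l | l. loewner_le \<tau> ((2 powr l) *\<^sub>R \<tau>')}"

definition min_entropy :: "complex ^ ('a::finite \<times> 'b::finite) ^ ('a \<times> 'b) \<Rightarrow> ereal"
  where "min_entropy \<rho> =
    - (INF \<sigma>\<in>{\<sigma> :: complex ^ 'b ^ 'b. density_operator \<sigma>}. D_infinity \<rho> (tensor_op (mat 1) \<sigma>))"

definition max_entangled ::
    "(nat \<Rightarrow> complex ^ 'a::finite) \<Rightarrow> (nat \<Rightarrow> complex ^ 'c::finite) \<Rightarrow> complex ^ ('a \<times> 'c)"
  where "max_entangled e f =
    (1 / sqrt (real CARD('a))) *\<^sub>R (\<Sum>x=1..CARD('a). tensor_vec (e x) (f x))"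

definition sq_fidelity_after ::
    "(nat \<Rightarrow> complex ^ 'a::finite) \<Rightarrow> (nat \<Rightarrow> complex ^ 'c::finite) \<Rightarrow>
     complex ^ ('a \<times> 'b::finite) ^ ('a \<times> 'b) \<Rightarrow> (complex ^ 'b ^ 'b \<Rightarrow> complex ^ 'c ^ 'c) \<Rightarrow> real"
  where "sq_fidelity_after e f \<rho> F =
    (fidelity (id_tensor F \<rho>) (ket_bra (max_entangled e f)))\<^sup>2"

text \<open>A supremum; this is the maximum as soon as \<open>sq_fidelity_after e f \<rho>\<close> attains one on the
  quantum operations.\<close>

definition q_corr ::
    "(nat \<Rightarrow> complex ^ 'a::finite) \<Rightarrow> (nat \<Rightarrow> complex ^ 'c::finite) \<Rightarrow>
     complex ^ ('a \<times> 'b::finite) ^ ('a \<times> 'b) \<Rightarrow> real"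
  where "q_corr e f \<rho> =
    real CARD('a) * (SUP F\<in>{F. quantum_operation F}. sq_fidelity_after e f \<rho> F)"


subsection \<open>Agreement of the block encodings with the tensor product\<close>

lemma vector_space_cscale:
  "vector_space (cscale :: complex \<Rightarrow> complex ^ 'n ^ 'm \<Rightarrow> complex ^ 'n ^ 'm)"
  by unfold_locales (simp_all add: cscale_def vec_eq_iff algebra_simps)

lemma linear_cscale_iff:
  "Vector_Spaces.linear cscale cscale (F :: complex ^ 'n ^ 'm \<Rightarrow> complex ^ 'k ^ 'l) \<longleftrightarrow>
     (\<forall>X Y. F (X + Y) = F X + F Y) \<and> (\<forall>c X. F (cscale c X) = cscale c (F X))"
  unfolding Vector_Spaces.linear_iff
  using vector_space_cscale[where 'n='n and 'm='m] vector_space_cscale[where 'n='k and 'm='l]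
  by (auto simp: vector_space_pair_def)

lemma block_id_tensor: "block (id_tensor F X) i k = F (block X i k)"
  by (subst block_def) (simp add: id_tensor_def vec_eq_iff)

lemma block_eqI: "(\<And>i k. block X i k = block Y i k) \<Longrightarrow> X = Y"
  by (auto simp: block_def vec_eq_iff)

lemma block_tensor_op: "block (tensor_op A B) i k = cscale (A $ i $ k) B"
  by (simp add: block_def tensor_op_def cscale_def)

lemma id_tensor_tensor_op:
  assumes "Vector_Spaces.linear cscale cscale F"
  shows "id_tensor F (tensor_op A B) = tensor_op A (F B)"
  using assms by (intro block_eqI) (simp add: block_id_tensor block_tensor_op linear_cscale_iff)

lemma cinner_block:
  fixes X :: "complex ^ ('m::finite \<times> 'n::finite) ^ ('m \<times> 'n)"
  shows "cinner v (X *v v) =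
    (\<Sum>i\<in>UNIV. \<Sum>k\<in>UNIV. cinner (\<chi> j. v $ (i, j)) (block X i k *v (\<chi> l. v $ (k, l))))"
proof -
  have "cinner v (X *v v) =
    (\<Sum>i\<in>UNIV. \<Sum>j\<in>UNIV. \<Sum>k\<in>UNIV. \<Sum>l\<in>UNIV. cnj (v $ (i, j)) * (X $ (i, j) $ (k, l) * v $ (k, l)))"
    unfolding cinner_def matrix_vector_mult_def UNIV_Times_UNIV[symmetric]
    by (simp add: sum.cartesian_product' sum_distrib_left del: UNIV_Times_UNIV)
  also have "\<dots> = (\<Sum>i\<in>UNIV. \<Sum>k\<in>UNIV. \<Sum>j\<in>UNIV. \<Sum>l\<in>UNIV.
      cnj (v $ (i, j)) * (X $ (i, j) $ (k, l) * v $ (k, l)))"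
    by (intro sum.cong refl sum.swap)
  finally show ?thesis
    by (simp add: cinner_def matrix_vector_mult_def block_def sum_distrib_left)
qed

lemma psd_iff_block_psd:
  fixes X :: "complex ^ ('m::finite \<times> 'n::finite) ^ ('m \<times> 'n)"
  assumes g: "bij_betw g {..<r} (UNIV :: 'm set)"
  shows "psd X \<longleftrightarrow> block_psd r (\<lambda>i k. block X (g i) (g k))"
proof -
  have re: "(\<Sum>i\<in>UNIV. \<Sum>k\<in>UNIV. h i k) = (\<Sum>i<r. \<Sum>k<r. h (g i) (g k))"
    for h :: "'m \<Rightarrow> 'm \<Rightarrow> complex"
    by (simp add: sum.reindex_bij_betw[OF g, symmetric])
  show ?thesis
  proof
    assume X: "psd X"
    show "block_psd r (\<lambda>i k. block X (g i) (g k))"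
      unfolding block_psd_def
    proof
      fix v :: "nat \<Rightarrow> complex ^ 'n"
      define w :: "complex ^ ('m \<times> 'n)"
        where "w = (\<chi> p. v (inv_into {..<r} g (fst p)) $ snd p)"
      have w: "(\<chi> j. w $ (g i, j)) = v i" if "i < r" for i
        using that bij_betw_imp_inj_on[OF g] by (simp add: w_def vec_eq_iff inv_into_f_f)
      have "cinner w (X *v w) = (\<Sum>i<r. \<Sum>k<r. cinner (v i) (block X (g i) (g k) *v v k))"
        unfolding cinner_block re by (intro sum.cong refl) (simp add: w)
      then show "(\<Sum>i<r. \<Sum>k<r. cinner (v i) (block X (g i) (g k) *v v k)) \<in> \<real>\<^sub>\<ge>\<^sub>0"
        using X by (metis psd_def)
    qed
  next
    assume "block_psd r (\<lambda>i k. block X (g i) (g k))"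
    then show "psd X"
      unfolding psd_def cinner_block re block_psd_def
      by (intro allI) (erule_tac x = "\<lambda>i. \<chi> j. v $ (g i, j)" in allE)
  qed
qed

lemma completely_positive_imp_psd:
  fixes F :: "complex ^ 'n::finite ^ 'n \<Rightarrow> complex ^ 'k::finite ^ 'k"
    and X :: "complex ^ ('m::finite \<times> 'n) ^ ('m \<times> 'n)"
  assumes "completely_positive F" "psd X"
  shows "psd (id_tensor F X)"
proof -
  obtain g where g: "bij_betw g {..<CARD('m)} (UNIV :: 'm set)"
    using ex_bij_betw_nat_finite[of "UNIV :: 'm set"] by (auto simp: atLeast0LessThan)
  show ?thesis
    using assms by (simp add: block_id_tensor psd_iff_block_psd[OF g] completely_positive_def)
qed

end

theory Submission
  imports Defs
begin

text \<open>
  Since \<open>|\<Phi>><\<Phi>|\<close> is a projection, the squared fidelity is \<open><\<Phi>|(id \<otimes> F)(\<rho>)|\<Phi>>\<close>. Passing to Choi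
  matrices, \<open>q_corr\<close> becomes the maximum of \<open>tr (\<rho> E)\<close> over \<open>E \<ge> 0\<close> with \<open>tr\<^sub>A E = 1\<close>, and
  \<open>2 powr (- H_min)\<close> is the minimum of \<open>tr \<sigma>\<close> over \<open>1 \<otimes> \<sigma> \<ge> \<rho>\<close>. Weak duality is immediate. For strong
  duality no separation theorem is needed: compactness yields a maximiser \<open>E\<close>, and its first-order
  optimality condition says that the Hermitian part \<open>\<sigma>\<close> of \<open>tr\<^sub>A (E \<rho>)\<close> satisfies \<open>1 \<otimes> \<sigma> \<ge> \<rho>\<close>,
  while \<open>tr \<sigma> = tr (\<rho> E)\<close>.
\<close>

subsection \<open>Positive semidefinite matrices\<close>

text \<open>The candidate \<open>\<sigma>\<close> comes from complementary slackness: an optimal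
  pair satisfies \<open>(1 \<otimes> \<sigma> - \<rho>) E = 0\<close>, and tracing out A, with
  \<open>tr_A E = 1\<close>, leaves \<open>\<sigma> = tr_A (\<rho> E)\<close>. At this stage that
  operator is not known to be Hermitian, hence the Hermitian part. The obstacle is the equality
  constraint: adding \<open>\<epsilon> |v><v|\<close> to \<open>E\<close> violates it, and
  subtracting an operator to compensate may destroy positivity. Conjugating \<open>E\<close> by an
  operator on B keeps positivity and compensates to first order. The second-order excess is removed
  by rescaling, and the deficit this leaves is filled up at no cost because
  \<open>\<rho> \<ge> 0\<close>. \<open>psd_sqrt\<close> is a definite description, so the fidelity
  cannot be evaluated until square roots are known to exist and to be unique. Here compactness
  stands in for the spectral theorem: elimination of pivots gives
  \<open>A = cadjoint C ** C\<close>, and a maximising unitary \<open>U\<close> makes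
  \<open>U ** C\<close> the root of \<open>A\<close>.\<close>

lemma cinner_add_left: "cinner (u + v) w = cinner u w + cinner v w"
  by (simp add: cinner_def algebra_simps sum.distrib)

lemma cinner_add_right: "cinner u (v + w) = cinner u v + cinner u w"
  by (simp add: cinner_def algebra_simps sum.distrib)

lemma cinner_diff_right: "cinner u (v - w) = cinner u v - cinner u w"
  by (simp add: cinner_def algebra_simps sum_subtractf)

lemma cinner_zero_right [simp]: "cinner u 0 = 0"
  by (simp add: cinner_def)

lemma cinner_scale_left: "cinner (c *s v) w = cnj c * cinner v w"
  by (simp add: cinner_def sum_distrib_left mult_ac)

lemma cinner_scale_right: "cinner v (c *s w) = c * cinner v w"
  by (simp add: cinner_def sum_distrib_left mult_ac)

lemma cinner_scaleR_right: "cinner v (c *\<^sub>R w) = of_real c * cinner v w"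
  by (simp add: cinner_def scaleR_sum_right flip: scaleR_conv_of_real)

lemma cinner_scaleR_left: "cinner (c *\<^sub>R v) w = of_real c * cinner v w"
  by (simp add: cinner_def scaleR_sum_right flip: scaleR_conv_of_real)

lemma cinner_sum_right: "cinner v (\<Sum>i\<in>I. g i) = (\<Sum>i\<in>I. cinner v (g i))"
  by (induction I rule: infinite_finite_induct) (auto simp: cinner_add_right)

lemma cinner_commute: "cinner v w = cnj (cinner w v)"
  by (simp add: cinner_def mult.commute)

lemma cinner_sum_left: "cinner (\<Sum>i\<in>I. g i) v = (\<Sum>i\<in>I. cinner (g i) v)"
  by (subst (1 2) cinner_commute) (simp add: cinner_sum_right)

lemma Re_cinner: "Re (cinner v w) = v \<bullet> w"
  by (simp add: cinner_def inner_vec_def inner_complex_def)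

lemma cinner_self: "cinner v v = of_real ((norm v)\<^sup>2)"
proof (rule complex_eqI)
  have "cinner v v = cnj (cinner v v)" by (rule cinner_commute)
  then show "Im (cinner v v) = Im (of_real ((norm v)\<^sup>2))"
    by (metis Im_complex_of_real Reals_cnj_iff complex_is_Real_iff)
qed (simp add: Re_cinner power2_norm_eq_inner)

lemma cinner_axis_left: "cinner (axis i 1) v = v $ i"
  by (simp add: cinner_def axis_def if_distrib if_distribR cong: if_cong)

lemma mult_axis: "A *v axis i 1 = column i A" for A :: "complex ^ 'n ^ 'm"
  by (simp add: matrix_vector_mult_def column_def axis_def vec_eq_iff if_distrib cong: if_cong)

lemma cinner_axis: "cinner (axis i 1) (A *v axis j 1) = A $ i $ j"
  by (simp add: cinner_axis_left mult_axis column_def)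

lemma cinner_cadjoint: "cinner v (A *v w) = cinner (cadjoint A *v v) w"
proof -
  have "cinner v (A *v w) = (\<Sum>i\<in>UNIV. \<Sum>j\<in>UNIV. cnj (v $ i) * A $ i $ j * w $ j)"
    by (simp add: cinner_def matrix_vector_mult_def sum_distrib_left mult_ac)
  also have "\<dots> = (\<Sum>j\<in>UNIV. \<Sum>i\<in>UNIV. cnj (v $ i) * A $ i $ j * w $ j)"
    by (rule sum.swap)
  finally show ?thesis
    by (simp add: cinner_def matrix_vector_mult_def cadjoint_def sum_distrib_left sum_distrib_right mult_ac)
qed

lemma matrix_eqI_cinner:
  assumes "\<And>v w. cinner v (A *v w) = cinner v (B *v w)"
  shows "A = B"
  using assms[of "axis _ 1" "axis _ 1"] by (simp add: cinner_axis vec_eq_iff)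

section \<open>Algebra of adjoints, real scalars and finite sums\<close>

lemma cadjoint_cadjoint [simp]: "cadjoint (cadjoint A) = A"
  by (simp add: cadjoint_def vec_eq_iff)

lemma cadjoint_mult: "cadjoint (A ** B) = cadjoint B ** cadjoint A"
  by (simp add: cadjoint_def matrix_matrix_mult_def vec_eq_iff mult.commute)

lemma cadjoint_add: "cadjoint (A + B) = cadjoint A + cadjoint B"
  by (simp add: cadjoint_def vec_eq_iff)

lemma cadjoint_diff: "cadjoint (A - B) = cadjoint A - cadjoint B"
  by (simp add: cadjoint_def vec_eq_iff)

lemma cadjoint_scaleR: "cadjoint (c *\<^sub>R A) = c *\<^sub>R cadjoint A"
  by (simp add: cadjoint_def vec_eq_iff)

lemma cadjoint_mat_1 [simp]: "cadjoint (mat 1) = mat 1"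
  by (simp add: cadjoint_def mat_def vec_eq_iff)

lemma cadjoint_ket_bra [simp]: "cadjoint (ket_bra v) = ket_bra v"
  by (simp add: cadjoint_def ket_bra_def vec_eq_iff mult.commute)

lemma trace_scaleR: "trace (c *\<^sub>R A) = of_real c * trace A" for A :: "complex ^ 'n ^ 'n"
  by (simp add: trace_def scaleR_sum_right flip: scaleR_conv_of_real)

lemma matrix_diff_ldistrib: "A ** (B - C) = A ** B - A ** C" for A :: "complex ^ 'n ^ 'm"
  by (simp add: matrix_matrix_mult_def vec_eq_iff right_diff_distrib sum_subtractf)

lemma matrix_diff_rdistrib: "(B - C) ** A = B ** A - C ** A" for A :: "complex ^ 'n ^ 'm"
  by (simp add: matrix_matrix_mult_def vec_eq_iff left_diff_distrib sum_subtractf)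

lemma matrix_add_rdistrib: "(B + C) ** A = B ** A + C ** A" for A :: "complex ^ 'n ^ 'm"
  by (simp add: matrix_matrix_mult_def vec_eq_iff distrib_right sum.distrib)

lemma sum_mult_left: "(\<Sum>i\<in>I. h i) ** M = (\<Sum>i\<in>I. h i ** M)" for M :: "complex ^ 'n ^ 'm"
  by (induction I rule: infinite_finite_induct) (auto simp: matrix_add_rdistrib)

lemma sum_mult_right: "M ** (\<Sum>i\<in>I. h i) = (\<Sum>i\<in>I. M ** h i)" for M :: "complex ^ 'n ^ 'm"
  by (induction I rule: infinite_finite_induct) (auto simp: matrix_add_ldistrib)

lemma sum_mult_vec: "(\<Sum>i\<in>I. h i) *v v = (\<Sum>i\<in>I. h i *v v)" for v :: "complex ^ 'n"
  by (induction I rule: infinite_finite_induct) (auto simp: matrix_vector_mult_add_rdistrib)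

lemma scaleR_mult_left: "(c *\<^sub>R A) ** B = c *\<^sub>R (A ** B)" for A :: "complex ^ 'n ^ 'm"
  by (simp add: matrix_matrix_mult_def vec_eq_iff scaleR_sum_right)

lemma scaleR_mult_right: "A ** (c *\<^sub>R B) = c *\<^sub>R (A ** B)" for A :: "complex ^ 'n ^ 'm"
  by (simp add: matrix_matrix_mult_def vec_eq_iff scaleR_sum_right)

lemma scaleR_mult_vec: "(c *\<^sub>R A) *v x = c *\<^sub>R (A *v x)" for A :: "complex ^ 'n ^ 'm"
  by (simp add: matrix_vector_mult_def vec_eq_iff scaleR_sum_right)

lemma ket_bra_mult_vec: "ket_bra v *v w = cinner v w *s v"
  by (simp add: ket_bra_def matrix_vector_mult_def vec_eq_iff cinner_def sum_distrib_left mult_ac)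

lemma trace_ket_bra_mult: "trace (A ** ket_bra v) = cinner v (A *v v)"
  by (simp add: trace_def matrix_matrix_mult_def ket_bra_def cinner_def matrix_vector_mult_def
      sum_distrib_left sum_distrib_right mult_ac)

section \<open>The cone of nonnegative operators\<close>

lemma psd_add: "psd A \<Longrightarrow> psd B \<Longrightarrow> psd (A + B)"
  by (auto simp: psd_def matrix_vector_mult_add_rdistrib cinner_add_right intro: nonneg_Reals_add_I)

lemma psd_scaleR: "psd A \<Longrightarrow> 0 \<le> c \<Longrightarrow> psd (c *\<^sub>R A)"
  by (auto simp: psd_def scaleR_mult_vec cinner_scaleR_right intro: nonneg_Reals_mult_I)

lemma psd_mat_1: "psd (mat 1)"
  by (simp add: psd_def cinner_self)

lemma psd_conj: "psd A \<Longrightarrow> psd (cadjoint B ** A ** B)"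
  unfolding psd_def
  by (metis cadjoint_cadjoint cinner_cadjoint matrix_vector_mul_assoc)

lemma psd_cadjoint_mult: "psd (cadjoint B ** B)"
  using psd_conj[OF psd_mat_1, of B] by simp

lemma psd_ket_bra: "psd (ket_bra v)"
  by (auto simp: psd_def ket_bra_mult_vec cinner_scale_right complex_nonneg_Reals_iff
      cinner_commute[of _ v] mult.commute[of _ "cnj _"] simp flip: complex_norm_square)

text \<open>Polarisation: the form is real at \<open>v + w\<close> and at \<open>v + \<i> w\<close>.
  The first fact makes the imaginary parts of the two mixed terms opposite, the second makes their
  real parts equal.\<close>

lemma psd_cinner_commute:
  assumes "psd A" shows "cinner w (A *v v) = cnj (cinner v (A *v w))"
proof -
  have "cinner (v + c *s w) (A *v (v + c *s w)) = cinner v (A *v v) + c * cinner v (A *v w)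
      + cnj c * cinner w (A *v v) + (cnj c * c) * cinner w (A *v w)" for c
    by (simp add: matrix_vector_right_distrib vector_scalar_commute cinner_add_left cinner_add_right
        cinner_scale_left cinner_scale_right algebra_simps)
  from this[of 1] this[of \<i>] show ?thesis
    using assms[unfolded psd_def complex_nonneg_Reals_iff, rule_format, of v]
      assms[unfolded psd_def complex_nonneg_Reals_iff, rule_format, of w]
      assms[unfolded psd_def complex_nonneg_Reals_iff, rule_format, of "v + 1 *s w"]
      assms[unfolded psd_def complex_nonneg_Reals_iff, rule_format, of "v + \<i> *s w"]
    by (auto simp: complex_eq_iff)
qed

lemma psd_cadjoint: "psd A \<Longrightarrow> cadjoint A = A"
  by (rule matrix_eqI_cinner) (metis cadjoint_cadjoint cinner_cadjoint cinner_commute psd_cinner_commute)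

lemma psdI_cadjoint:
  assumes "cadjoint A = A" "\<And>v. 0 \<le> Re (cinner v (A *v v))" shows "psd A"
  unfolding psd_def complex_nonneg_Reals_iff
proof (intro allI conjI assms(2))
  fix v
  have "cinner v (A *v v) = cnj (cinner v (A *v v))"
    by (metis assms(1) cinner_cadjoint cinner_commute)
  then show "Im (cinner v (A *v v)) = 0"
    by (metis Reals_cnj_iff complex_is_Real_iff)
qed

text \<open>A Cauchy-Schwarz inequality with the arithmetic mean in place of the geometric one,
  which is all that the entrywise bounds require.\<close>

lemma psd_norm_cinner_le:
  assumes "psd A"
  shows "2 * norm (cinner v (A *v w)) \<le> Re (cinner v (A *v v)) + Re (cinner w (A *v w))"
proof -
  define z where "z = cinner v (A *v w)"
  \<comment> \<open>The phase that turns the mixed term into \<open>- norm z\<close>, the worst case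
    for nonnegativity; for \<open>z = 0\<close> any phase would do.\<close>
  define c where "c = (if z = 0 then 1 else - cnj z / of_real (norm z))"
  have c: "cnj c * c = 1" "c * z = - of_real (norm z)"
    by (auto simp: c_def norm_divide mult.commute[of "cnj _"] power2_eq_square complex_norm_square[symmetric])
  have "cinner (v + c *s w) (A *v (v + c *s w)) = cinner v (A *v v) + c * z
      + cnj (c * z) + (cnj c * c) * cinner w (A *v w)"
    by (simp add: matrix_vector_right_distrib vector_scalar_commute cinner_add_left cinner_add_right
        cinner_scale_left cinner_scale_right algebra_simps z_def psd_cinner_commute[OF assms, of v w])
  then have "Re (cinner (v + c *s w) (A *v (v + c *s w))) =
      Re (cinner v (A *v v)) - 2 * norm z + Re (cinner w (A *v w))"
    unfolding c by simp
  moreover have "0 \<le> Re (cinner (v + c *s w) (A *v (v + c *s w)))"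
    using assms by (simp add: psd_def complex_nonneg_Reals_iff)
  ultimately show ?thesis by (simp add: z_def)
qed

lemma psd_diag: "psd A \<Longrightarrow> 0 \<le> Re (A $ i $ i)" "psd A \<Longrightarrow> Im (A $ i $ i) = 0"
  using cinner_axis[of i A i] by (metis psd_def complex_nonneg_Reals_iff)+

lemma psd_norm_entry_le:
  "psd A \<Longrightarrow> 2 * norm (A $ i $ j) \<le> Re (A $ i $ i) + Re (A $ j $ j)"
  using psd_norm_cinner_le[of A "axis i 1" "axis j 1"] by (simp add: cinner_axis)

lemma psd_trace_nonneg: "psd A \<Longrightarrow> trace A \<in> \<real>\<^sub>\<ge>\<^sub>0"
  by (simp add: trace_def complex_nonneg_Reals_iff psd_diag sum_nonneg)

text \<open>The nonnegative diagonal sums to zero, hence vanishes, and the diagonal dominates all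
  other entries.\<close>

lemma psd_trace_0:
  assumes "psd A" "Re (trace A) = 0" shows "A = 0"
proof -
  have "Re (A $ i $ i) = 0" for i
    using assms psd_diag(1)[OF assms(1)]
    by (auto simp: trace_def sum_nonneg_eq_0_iff)
  then show ?thesis
    using psd_norm_entry_le[OF assms(1)] by (simp add: vec_eq_iff)
qed

subsection \<open>Square roots and fidelity\<close>

text \<open>One step of Cholesky elimination: what remains is the Schur complement of the pivot
  \<open>A $ i $ i\<close>, bordered by zeros.\<close>

lemma psd_minus_ket_bra_column:
  fixes A :: "complex ^ 'n::finite ^ 'n"
  assumes A: "psd A" and pos: "0 < Re (A $ i $ i)"
  shows "psd (A - ket_bra ((1 / sqrt (Re (A $ i $ i))) *\<^sub>R column i A))"
  unfolding psd_def
proof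
  fix v
  define a where "a = Re (A $ i $ i)"
  define t where "t = cinner (axis i 1) (A *v v)"
  \<comment> \<open>This \<open>s\<close> minimises the form of \<open>A\<close> along
    \<open>v + s *s axis i 1\<close>; the minimum is the form of the Schur complement at
    \<open>v\<close>.\<close>
  define s where "s = - t / of_real a"
  define u where "u = v + s *s axis i 1"
  have Aii: "cinner (axis i 1) (A *v axis i 1) = of_real a"
    by (simp add: cinner_axis a_def complex_eq_iff psd_diag[OF A])
  have vi: "cinner v (A *v axis i 1) = cnj t"
    unfolding t_def by (rule psd_cinner_commute[OF A])
  then have t': "cinner v (column i A) = cnj t"
    by (simp add: mult_axis)
  have t'': "cinner (column i A) v = t"
    by (subst cinner_commute) (simp add: t')
  have a: "a > 0" using pos by (simp add: a_def)
  have "cinner u (A *v u) = cinner v (A *v v) + s * cnj t + cnj s * t + cnj s * s * of_real a"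
    by (simp add: u_def matrix_vector_right_distrib vector_scalar_commute cinner_add_left
        cinner_add_right cinner_scale_left cinner_scale_right Aii vi algebra_simps flip: t_def)
  also have "\<dots> = cinner v (A *v v) - t * cnj t / of_real a"
    using a by (simp add: s_def field_simps)
  also have "t * cnj t / of_real a = of_real (1 / sqrt a) * (of_real (1 / sqrt a) * (t * cnj t))"
    using a by (simp add: divide_simps flip: of_real_mult)
  also have "\<dots> = cinner v (ket_bra ((1 / sqrt a) *\<^sub>R column i A) *v v)"
    by (simp only: ket_bra_mult_vec cinner_scale_right cinner_scaleR_right cinner_scaleR_left t' t'' mult_ac)
  finally have "cinner v ((A - ket_bra ((1 / sqrt a) *\<^sub>R column i A)) *v v) = cinner u (A *v u)"
    by (simp only: cinner_diff_right matrix_vector_mult_diff_rdistrib)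
  then show "cinner v ((A - ket_bra ((1 / sqrt (Re (A $ i $ i))) *\<^sub>R column i A)) *v v) \<in> \<real>\<^sub>\<ge>\<^sub>0"
    using A unfolding psd_def a_def by metis
qed

text \<open>Cholesky decomposition by induction on the set \<open>I\<close> of pivots still to be
  eliminated; elsewhere the diagonal is already zero.\<close>

lemma psd_sum_ket_bra:
  assumes "finite I" "psd A" "\<And>i. i \<notin> I \<Longrightarrow> A $ i $ i = 0"
  shows "\<exists>\<eta>. A = (\<Sum>i\<in>I. ket_bra (\<eta> i))"
  using assms
proof (induction I arbitrary: A)
  case empty
  then have "A = 0" by (intro psd_trace_0) (auto simp: trace_def)
  then show ?case by simp
next
  case (insert i I)
  define x where "x = (if A $ i $ i = 0 then 0 else (1 / sqrt (Re (A $ i $ i))) *\<^sub>R column i A)"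
  have Aii: "A $ i $ i = of_real (Re (A $ i $ i))"
    by (simp add: complex_eq_iff psd_diag[OF insert.prems(1)])
  have p: "psd (A - ket_bra x)"
  proof (cases "A $ i $ i = 0")
    case True
    then have "ket_bra x = 0" by (simp add: x_def ket_bra_def vec_eq_iff)
    then show ?thesis using insert.prems by simp
  next
    case False
    then have "Re (A $ i $ i) \<noteq> 0" using Aii by (metis of_real_0)
    then show ?thesis
      using False psd_minus_ket_bra_column[OF insert.prems(1), of i] psd_diag(1)[OF insert.prems(1), of i]
      by (simp add: x_def)
  qed
  have "(A - ket_bra x) $ j $ j = 0" if "j \<notin> I" for j
  proof (cases "j = i")
    case True
    define a where "a = Re (A $ i $ i)"
    have a: "0 \<le> a" "A $ i $ i = of_real a"
      using Aii psd_diag[OF insert.prems(1)] by (simp_all add: a_def)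
    have "x $ i = of_real (a / sqrt a)"
      using a by (simp add: x_def column_def scaleR_conv_of_real[where 'a = complex])
    then have "x $ i * cnj (x $ i) = of_real a"
      using a by (simp add: real_div_sqrt flip: of_real_mult)
    then show ?thesis
      by (simp add: True ket_bra_def a)
  next
    case False
    then have "A $ j $ j = 0" using that insert.prems by auto
    \<comment> \<open>Subtracting \<open>ket_bra x\<close> can only lower a diagonal entry, and
      positivity of the difference forbids going below zero.\<close>
    then have "Re ((A - ket_bra x) $ j $ j) \<le> 0"
      by (simp add: ket_bra_def)
    then show ?thesis using psd_diag[OF p, of j] by (simp add: complex_eq_iff)
  qed
  then obtain \<eta> where "A - ket_bra x = (\<Sum>i\<in>I. ket_bra (\<eta> i))"
    using insert.IH[OF p] by blast
  moreover have "(\<Sum>j\<in>I. ket_bra ((\<eta>(i := x)) j)) = (\<Sum>j\<in>I. ket_bra (\<eta> j))"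
    using insert.hyps by (intro sum.cong) auto
  ultimately have "A = (\<Sum>j\<in>insert i I. ket_bra ((\<eta>(i := x)) j))"
    using insert.hyps by (simp add: diff_eq_eq add.commute del: fun_upd_apply) simp
  then show ?case by blast
qed

lemma psd_imp_cadjoint_mult:
  fixes A :: "complex ^ 'n::finite ^ 'n"
  assumes "psd A" shows "\<exists>C :: complex ^ 'n ^ 'n. A = cadjoint C ** C"
proof -
  obtain \<eta> where "A = (\<Sum>i\<in>(UNIV :: 'n set). ket_bra (\<eta> i))"
    using psd_sum_ket_bra[OF finite assms] by blast
  moreover have "cadjoint (\<chi> i j. cnj (\<eta> i $ j)) ** (\<chi> i j. cnj (\<eta> i $ j)) = (\<Sum>i\<in>UNIV. ket_bra (\<eta> i))"
    by (simp add: vec_eq_iff cadjoint_def matrix_matrix_mult_def ket_bra_def)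
  ultimately show ?thesis by metis
qed

section \<open>Compactness of the unitaries and the polar form\<close>

lemma bounded_matrices:
  fixes S :: "(complex ^ 'n::finite ^ 'm::finite) set"
  assumes "\<And>A i j. A \<in> S \<Longrightarrow> norm (A $ i $ j) \<le> c"
  shows "bounded S"
proof (rule boundedI)
  fix A assume "A \<in> S"
  have "norm A \<le> (\<Sum>i\<in>UNIV. norm (A $ i))"
    unfolding norm_vec_def by (rule L2_set_le_sum) simp
  also have "\<dots> \<le> (\<Sum>i\<in>UNIV. \<Sum>j\<in>UNIV. norm (A $ i $ j))"
    unfolding norm_vec_def[of "_ $ _"] by (intro sum_mono L2_set_le_sum) simp
  also have "\<dots> \<le> (\<Sum>i\<in>(UNIV::'m set). \<Sum>j\<in>(UNIV::'n set). c)"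
    by (intro sum_mono assms \<open>A \<in> S\<close>)
  finally show "norm A \<le> (\<Sum>i\<in>(UNIV::'m set). \<Sum>j\<in>(UNIV::'n set). c)" .
qed

lemma compact_unitary: "compact {U :: complex ^ 'n::finite ^ 'n. cadjoint U ** U = mat 1}"
  unfolding compact_eq_bounded_closed
proof
  have eq: "{U :: complex ^ 'n ^ 'n. cadjoint U ** U = mat 1} =
      {U. \<forall>i j. (\<Sum>k\<in>UNIV. cnj (U $ k $ i) * U $ k $ j) = (if i = j then 1 else 0)}"
    by (simp add: vec_eq_iff cadjoint_def matrix_matrix_mult_def mat_def)
  show "closed {U :: complex ^ 'n ^ 'n. cadjoint U ** U = mat 1}"
    unfolding eq by (intro closed_Collect_all closed_Collect_eq continuous_intros)
  show "bounded {U :: complex ^ 'n ^ 'n. cadjoint U ** U = mat 1}"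
  proof (rule bounded_matrices)
    fix U :: "complex ^ 'n ^ 'n" and i j assume "U \<in> {U. cadjoint U ** U = mat 1}"
    then have "(\<Sum>k\<in>UNIV. cnj (U $ k $ j) * U $ k $ j) = 1"
      unfolding eq by auto
    then have "of_real (\<Sum>k\<in>UNIV. (norm (U $ k $ j))\<^sup>2) = (1 :: complex)"
      by (simp only: of_real_sum complex_norm_square mult.commute)
    then have "(\<Sum>k\<in>UNIV. (norm (U $ k $ j))\<^sup>2) = 1"
      by (simp only: of_real_eq_1_iff)
    moreover have "(norm (U $ i $ j))\<^sup>2 \<le> (\<Sum>k\<in>UNIV. (norm (U $ k $ j))\<^sup>2)"
      by (intro member_le_sum) auto
    ultimately show "norm (U $ i $ j) \<le> 1"
      using power2_le_imp_le[of "norm (U $ i $ j)" 1] by simp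
  qed
qed

text \<open>\<open>V\<close> multiplies \<open>v\<close> by \<open>\<omega>\<close> and fixes the
  orthogonal complement of \<open>v\<close>; for \<open>\<omega> = -1\<close> it is a Householder
  reflection.\<close>

lemma unitary_phase:
  assumes v: "norm v = 1" and \<omega>: "norm \<omega> = 1"
  defines "V \<equiv> mat 1 - cscale (1 - \<omega>) (ket_bra v)"
  shows "cadjoint V ** V = mat 1"
proof (rule matrix_eqI_cinner)
  fix x y
  have V: "V *v x = x + (- (1 - \<omega>) * cinner v x) *s v" for x
    unfolding V_def matrix_vector_mult_diff_rdistrib
    by (simp add: cscale_def ket_bra_def matrix_vector_mult_def vec_eq_iff cinner_def sum_distrib_left sum_distrib_right
        algebra_simps mat_def if_distrib if_distribR sum_subtractf cong: if_cong)
  have vv: "cinner v v = 1" using v by (simp add: cinner_self)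
  have w: "\<omega> * cnj \<omega> = 1" using \<omega> by (simp flip: complex_norm_square)
  have "cinner x ((cadjoint V ** V) *v y) = cinner (V *v x) (V *v y)"
    by (metis cadjoint_cadjoint cinner_cadjoint matrix_vector_mul_assoc)
  also have "\<dots> = cinner x y + (\<omega> * cnj \<omega> - 1) * cinner x v * cinner v y"
    unfolding V cinner_add_left cinner_add_right cinner_scale_left cinner_scale_right vv
    by (simp add: cinner_commute[of v x] algebra_simps)
  finally show "cinner x ((cadjoint V ** V) *v y) = cinner x (mat 1 *v y)"
    by (simp add: w)
qed

text \<open>A unitary maximising \<open>Re (tr (U C))\<close> puts \<open>U C\<close> in polar form: otherwise rotating the
  phase of one vector would increase the trace.\<close>

lemma polar_psd:
  fixes C :: "complex ^ 'n::finite ^ 'n"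
  shows "\<exists>U. cadjoint U ** U = mat 1 \<and> psd (U ** C)"
proof -
  let ?U = "{U :: complex ^ 'n ^ 'n. cadjoint U ** U = mat 1}"
  have ne: "?U \<noteq> {}" using cadjoint_mat_1 by (metis (mono_tags) empty_Collect_eq matrix_mul_lid)
  have cont: "continuous_on ?U (\<lambda>U. Re (trace (U ** C)))"
    unfolding trace_def matrix_matrix_mult_def by (simp, intro continuous_intros)
  obtain U where U: "cadjoint U ** U = mat 1"
    and max: "\<And>V. cadjoint V ** V = mat 1 \<Longrightarrow> Re (trace (V ** C)) \<le> Re (trace (U ** C))"
    using continuous_attains_sup[OF compact_unitary ne cont] by auto
  define P where "P = U ** C"
  have unit: "cinner v (P *v v) = of_real (norm (cinner v (P *v v)))" if v: "norm v = 1" for v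
  proof -
    define z where "z = cinner v (P *v v)"
    \<comment> \<open>Rotating \<open>v\<close> by this phase changes the trace by
      \<open>(\<omega> - 1) * z\<close>, that is by \<open>norm z - z\<close>, so maximality forces
      \<open>norm z \<le> Re z\<close>.\<close>
    define \<omega> where "\<omega> = (if z = 0 then 1 else cnj z / of_real (norm z))"
    have \<omega>: "norm \<omega> = 1" "\<omega> * z = of_real (norm z)"
      by (auto simp: \<omega>_def norm_divide mult.commute[of "cnj _"] power2_eq_square complex_norm_square[symmetric])
    define V where "V = mat 1 - cscale (1 - \<omega>) (ket_bra v)"
    have "cadjoint V ** V = mat 1" unfolding V_def by (rule unitary_phase[OF v \<omega>(1)])
    then have "cadjoint (V ** U) ** (V ** U) = mat 1"
      by (metis U cadjoint_mult matrix_mul_assoc matrix_mul_rid)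
    then have "Re (trace (V ** P)) \<le> Re (trace P)"
      using max by (simp add: P_def matrix_mul_assoc)
    also have "V ** P = P - cscale (1 - \<omega>) (ket_bra v ** P)"
      unfolding V_def matrix_diff_rdistrib
      by (simp add: matrix_matrix_mult_def cscale_def vec_eq_iff sum_distrib_left mult.assoc mat_def
          if_distrib if_distribR cong: if_cong)
    also have "trace \<dots> = trace P - (1 - \<omega>) * z"
      unfolding z_def trace_ket_bra_mult[symmetric] trace_mul_sym[of P]
      by (simp add: trace_def cscale_def sum_subtractf sum_distrib_left)
    finally have "norm z \<le> Re z" using \<omega>(2) by (simp add: algebra_simps)
    then have "Re z = norm z" using complex_Re_le_cmod[of z] by simp
    then show ?thesis unfolding z_def[symmetric]
      by (metis add_cancel_right_right cmod_power2 complex_eq_iff complex_of_real_def complex.sel zero_eq_power2)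
  qed
  have "psd P"
    unfolding psd_def
  proof
    fix v
    show "cinner v (P *v v) \<in> \<real>\<^sub>\<ge>\<^sub>0"
    proof (cases "v = 0")
      case False
      define w where "w = (1 / norm v) *\<^sub>R v"
      have vw: "v = of_real (norm v) *s w"
        using False by (simp add: w_def vec_eq_iff scaleR_conv_of_real[where 'a = complex])
      have "norm w = 1" using False by (simp add: w_def)
      have "cinner v (P *v v) = of_real ((norm v)\<^sup>2) * cinner w (P *v w)"
        by (subst (1 2) vw)
          (simp add: vector_scalar_commute cinner_scale_left cinner_scale_right power2_eq_square mult_ac)
      also have "\<dots> = of_real ((norm v)\<^sup>2 * norm (cinner w (P *v w)))"
        by (subst unit[OF \<open>norm w = 1\<close>]) simp
      finally show ?thesis by (simp only: nonneg_Reals_of_real_iff) simp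
    qed simp
  qed
  then show ?thesis using U unfolding P_def by blast
qed

text \<open>The root of \<open>cadjoint C ** C\<close> is the absolute value of \<open>C\<close>:
  \<open>U ** C\<close> is Hermitian, so its square is \<open>cadjoint (U ** C) ** (U ** C)\<close>,
  from which the unitary cancels.\<close>

lemma psd_sqrt_exists:
  fixes A :: "complex ^ 'n::finite ^ 'n"
  assumes "psd A" shows "\<exists>S. psd S \<and> S ** S = A"
proof -
  obtain C :: "complex ^ 'n ^ 'n" where C: "A = cadjoint C ** C" using psd_imp_cadjoint_mult[OF assms] by blast
  obtain U where U: "cadjoint U ** U = mat 1" "psd (U ** C)" using polar_psd by blast
  have "(U ** C) ** (U ** C) = cadjoint (U ** C) ** (U ** C)"
    by (simp add: psd_cadjoint[OF U(2)])
  also have "\<dots> = cadjoint C ** (cadjoint U ** U) ** C"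
    by (simp add: cadjoint_mult matrix_mul_assoc)
  finally show ?thesis using U C by auto
qed

lemma cadjoint_mult_eq_0:
  assumes "cadjoint X ** X = 0" shows "X = 0"
proof (rule matrix_eqI_cinner)
  fix v w
  have "cinner (X *v w) (X *v w) = cinner w ((cadjoint X ** X) *v w)"
    by (metis cadjoint_cadjoint cinner_cadjoint matrix_vector_mul_assoc)
  then have "X *v w = 0" using assms by (simp add: cinner_self)
  then show "cinner v (X *v w) = cinner v (0 *v w)" by simp
qed

text \<open>With \<open>D = S - T\<close>, equality of the squares says
  \<open>S ** D + D ** T = 0\<close>. Hence the nonnegative operators \<open>D ** S ** D\<close> and
  \<open>D ** T ** D\<close> have traces summing to zero and both vanish. Their difference is the
  cube of the Hermitian \<open>D\<close>, so \<open>D = 0\<close>.\<close>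

lemma psd_sqrt_unique:
  assumes S: "psd S" and T: "psd T" and eq: "S ** S = T ** T"
  shows "S = T"
proof -
  define D where "D = S - T"
  have D: "cadjoint D = D" by (simp add: D_def cadjoint_diff psd_cadjoint S T)
  have p: "psd (D ** S ** D)" "psd (D ** T ** D)"
    using psd_conj[OF S, of D] psd_conj[OF T, of D] by (simp_all add: D)
  have "trace (D ** S ** D) + trace (D ** T ** D) = trace (D ** (S ** D)) + trace (D ** (D ** T))"
    by (metis matrix_mul_assoc trace_mul_sym)
  also have "\<dots> = trace (D ** (S ** D + D ** T))"
    by (simp add: matrix_add_ldistrib trace_add)
  also have "S ** D + D ** T = 0"
    by (simp add: D_def matrix_diff_ldistrib matrix_diff_rdistrib eq)
  finally have "trace (D ** S ** D) + trace (D ** T ** D) = 0"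
    by (simp add: trace_def)
  then have "Re (trace (D ** S ** D)) + Re (trace (D ** T ** D)) = 0"
    by (simp only: flip: plus_complex.sel) simp
  moreover have "0 \<le> Re (trace (D ** S ** D))" "0 \<le> Re (trace (D ** T ** D))"
    using psd_trace_nonneg[OF p(1)] psd_trace_nonneg[OF p(2)] by (simp_all add: complex_nonneg_Reals_iff)
  ultimately have "D ** S ** D = 0" "D ** T ** D = 0"
    using p by (auto intro!: psd_trace_0)
  then have "D ** D ** D = 0"
    by (subst (2) D_def) (simp add: matrix_diff_ldistrib matrix_diff_rdistrib)
  then have "cadjoint (D ** D) ** (D ** D) = 0"
    by (simp add: cadjoint_mult D matrix_mul_assoc)
  then have "cadjoint D ** D = 0" unfolding D by (rule cadjoint_mult_eq_0)
  then have "D = 0" by (rule cadjoint_mult_eq_0)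
  then show ?thesis by (simp add: D_def)
qed

lemma psd_sqrt_eq: "psd S \<Longrightarrow> S ** S = A \<Longrightarrow> psd_sqrt A = S"
  unfolding psd_sqrt_def by (rule the_equality) (auto intro: psd_sqrt_unique)

lemma psd_psd_sqrt: "psd A \<Longrightarrow> psd (psd_sqrt A)"
  and psd_sqrt_mult: "psd A \<Longrightarrow> psd_sqrt A ** psd_sqrt A = A"
  by (metis psd_sqrt_exists psd_sqrt_eq)+

text \<open>A projection is its own square root, so the trace norm concerns the root of
  \<open>P \<rho> P = t P\<close> with \<open>P = ket_bra \<phi>\<close>. That root is
  \<open>sqrt t *\<^sub>R P\<close>, of trace \<open>sqrt t\<close>.\<close>

lemma fidelity_pure:
  assumes \<rho>: "psd \<rho>" and \<phi>: "cinner \<phi> \<phi> = 1"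
  shows "(fidelity \<rho> (ket_bra \<phi>))\<^sup>2 = Re (cinner \<phi> (\<rho> *v \<phi>))"
proof -
  define t where "t = Re (cinner \<phi> (\<rho> *v \<phi>))"
  have t: "0 \<le> t" "cinner \<phi> (\<rho> *v \<phi>) = of_real t"
    using \<rho> by (auto simp: psd_def complex_nonneg_Reals_iff t_def complex_eq_iff)
  let ?P = "ket_bra \<phi>" and ?R = "psd_sqrt \<rho>"
  have PP: "?P ** ?P = ?P"
    by (rule matrix_eqI_cinner)
      (simp add: ket_bra_mult_vec vector_scalar_commute \<phi> cinner_scale_right flip: matrix_vector_mul_assoc)
  then have sP: "psd_sqrt ?P = ?P" by (intro psd_sqrt_eq psd_ket_bra)
  have "cadjoint (?R ** ?P) ** (?R ** ?P) = ?P ** (?R ** ?R) ** ?P"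
    by (simp add: cadjoint_mult psd_cadjoint[OF psd_psd_sqrt[OF \<rho>]] matrix_mul_assoc)
  also have "\<dots> = ?P ** \<rho> ** ?P" by (simp add: psd_sqrt_mult[OF \<rho>])
  also have "\<dots> = t *\<^sub>R ?P"
    by (rule matrix_eqI_cinner)
      (simp add: ket_bra_mult_vec vector_scalar_commute t scaleR_mult_vec cinner_scaleR_right
        cinner_scale_right flip: matrix_vector_mul_assoc)
  finally have "psd_sqrt (cadjoint (?R ** ?P) ** (?R ** ?P)) = sqrt t *\<^sub>R ?P"
    using t(1) by (intro psd_sqrt_eq psd_scaleR psd_ket_bra)
      (simp_all add: scaleR_mult_left scaleR_mult_right PP flip: real_sqrt_mult)
  moreover have "trace ?P = 1"
    using trace_ket_bra_mult[of "mat 1" \<phi>] \<phi> by simp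
  ultimately have "fidelity \<rho> ?P = sqrt t"
    by (simp add: fidelity_def sP trace_norm_def trace_scaleR)
  then show ?thesis using t(1) by (simp flip: t_def)
qed

subsection \<open>Partial trace and duality\<close>

lemma sum_UNIV_prod: "(\<Sum>p\<in>UNIV. h p) = (\<Sum>i\<in>UNIV. \<Sum>j\<in>UNIV. h (i, j))"
  for h :: "'m::finite \<times> 'n::finite \<Rightarrow> complex"
  unfolding UNIV_Times_UNIV[symmetric] by (simp add: sum.cartesian_product del: UNIV_Times_UNIV)

text \<open>By cyclicity the trace is that of \<open>B\<close> conjugated by a factor of
  \<open>A\<close>; the product \<open>A ** B\<close> itself need not be nonnegative.\<close>

lemma psd_trace_mult:
  fixes A B :: "complex ^ 'n::finite ^ 'n"
  assumes "psd A" "psd B" shows "trace (A ** B) \<in> \<real>\<^sub>\<ge>\<^sub>0"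
proof -
  obtain C :: "complex ^ 'n ^ 'n" where C: "A = cadjoint C ** C"
    using psd_imp_cadjoint_mult[OF assms(1)] by blast
  have "trace (A ** B) = trace (cadjoint (cadjoint C) ** B ** cadjoint C)"
    unfolding C cadjoint_cadjoint by (metis matrix_mul_assoc trace_mul_sym)
  then show ?thesis
    using psd_trace_nonneg[OF psd_conj[OF assms(2)]] by metis
qed

lemma psd_le_scaleR_mat_1:
  fixes A :: "complex ^ 'n::finite ^ 'n"
  assumes "psd A" shows "\<exists>c\<ge>0. psd (c *\<^sub>R mat 1 - A)"
proof -
  have "linear ((*v) A)"
    by (intro linearI) (simp_all add: matrix_vector_mult_def vec_eq_iff scaleR_sum_right distrib_left sum.distrib)
  then obtain c where c: "0 < c" "\<And>v. norm (A *v v) \<le> c * norm v"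
    using linear_bounded_pos by blast
  have "psd (c *\<^sub>R mat 1 - A)"
  proof (rule psdI_cadjoint)
    show "cadjoint (c *\<^sub>R mat 1 - A) = c *\<^sub>R mat 1 - A"
      by (simp add: cadjoint_diff cadjoint_scaleR psd_cadjoint assms)
    fix v
    have "v \<bullet> (A *v v) \<le> norm v * (c * norm v)"
      by (meson c(2) norm_cauchy_schwarz mult_left_mono norm_ge_zero order_trans)
    then show "0 \<le> Re (cinner v ((c *\<^sub>R mat 1 - A) *v v))"
      by (simp add: matrix_vector_mult_diff_rdistrib scaleR_mult_vec Re_cinner inner_diff_right
          dot_square_norm power2_eq_square mult_ac)
  qed
  then show ?thesis using c(1) by (intro exI[of _ c]) auto
qed

section \<open>Partial trace over A and the embedding of operators on B\<close>

definition ptrace :: "complex ^ ('a::finite \<times> 'b::finite) ^ ('a \<times> 'b) \<Rightarrow> complex ^ 'b ^ 'b"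
  where "ptrace X = (\<Sum>i\<in>UNIV. block X i i)"

abbreviation id_op :: "complex ^ 'b ^ 'b \<Rightarrow> complex ^ ('a::finite \<times> 'b::finite) ^ ('a \<times> 'b)"
  where "id_op \<equiv> tensor_op (mat 1)"

lemma block_add: "block (X + Y) i k = block X i k + block Y i k"
  by (simp add: block_def vec_eq_iff)

lemma block_diff: "block (X - Y) i k = block X i k - block Y i k"
  by (simp add: block_def vec_eq_iff)

lemma block_scaleR: "block (c *\<^sub>R X) i k = c *\<^sub>R block X i k"
  by (simp add: block_def vec_eq_iff)

lemma block_mult: "block (X ** Y) i k = (\<Sum>m\<in>UNIV. block X i m ** block Y m k)"
  by (simp add: block_def vec_eq_iff matrix_matrix_mult_def sum_UNIV_prod)

lemma block_cadjoint: "block (cadjoint X) i k = cadjoint (block X k i)"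
  by (simp add: block_def vec_eq_iff cadjoint_def)

lemma block_id_op: "block (id_op M) i k = (if i = k then M else 0)"
  by (simp add: block_tensor_op mat_def cscale_def vec_eq_iff)

lemma block_id_op_mult: "block (id_op M ** X) i k = M ** block X i k"
proof -
  have "block (id_op M ** X) i k = (\<Sum>m\<in>UNIV. if i = m then M ** block X m k else 0)"
    unfolding block_mult block_id_op by (intro sum.cong) auto
  then show ?thesis by simp
qed

lemma block_mult_id_op: "block (X ** id_op M) i k = block X i k ** M"
proof -
  have "block (X ** id_op M) i k = (\<Sum>m\<in>UNIV. if m = k then block X i m ** M else 0)"
    unfolding block_mult block_id_op by (intro sum.cong) auto
  then show ?thesis by simp
qed

lemma ptrace_add: "ptrace (X + Y) = ptrace X + ptrace Y"
  by (simp add: ptrace_def block_add sum.distrib)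

lemma ptrace_scaleR: "ptrace (c *\<^sub>R X) = c *\<^sub>R ptrace X"
  by (simp add: ptrace_def block_scaleR scaleR_sum_right)

lemma ptrace_id_op_mult: "ptrace (id_op M ** X) = M ** ptrace X"
  by (simp add: ptrace_def block_id_op_mult sum_mult_right)

lemma ptrace_mult_id_op: "ptrace (X ** id_op M) = ptrace X ** M"
  by (simp add: ptrace_def block_mult_id_op sum_mult_left)

lemma ptrace_cadjoint: "ptrace (cadjoint X) = cadjoint (ptrace X)"
  unfolding ptrace_def block_cadjoint by (simp add: cadjoint_def vec_eq_iff)

lemma trace_ptrace: "trace (ptrace X) = trace X"
  by (simp add: trace_def ptrace_def block_def sum_UNIV_prod) (rule sum.swap)

text \<open>\<open>id_op\<close> and \<open>ptrace\<close> are adjoint for the trace pairing; this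
  links the constraint on \<open>E\<close> with the dual variable \<open>\<sigma>\<close>.\<close>

lemma trace_id_op_mult: "trace (id_op M ** X) = trace (M ** ptrace X)"
  by (metis ptrace_id_op_mult trace_ptrace)

lemma ptrace_id_op: "ptrace (id_op M :: complex ^ ('a::finite \<times> 'b::finite) ^ ('a \<times> 'b)) = real CARD('a) *\<^sub>R M"
  by (simp add: ptrace_def block_id_op) (simp add: vec_eq_iff sum_constant_scaleR del: sum_constant flip: sum_constant)

lemma id_op_diff: "id_op (M - N) = id_op M - id_op N"
  by (rule block_eqI) (simp add: block_id_op block_diff)

lemma id_op_scaleR: "id_op (c *\<^sub>R M) = c *\<^sub>R id_op M"
  by (rule block_eqI) (simp add: block_id_op block_scaleR)

lemma id_op_mat_1: "id_op (mat 1) = mat 1"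
  by (simp add: tensor_op_def mat_def vec_eq_iff prod_eq_iff)

lemma cadjoint_id_op: "cadjoint (id_op M) = id_op (cadjoint M)"
  by (rule block_eqI, unfold block_cadjoint block_id_op) (simp add: cadjoint_def vec_eq_iff)

lemma cinner_tensor_axis:
  "cinner (tensor_vec (axis i 1) v) (X *v tensor_vec (axis i 1) v) = cinner v (block X i i *v v)"
proof -
  have eq: "(\<chi> j. tensor_vec (axis i 1) v $ (k, j)) = (if k = i then v else 0)" for k
    by (simp add: tensor_vec_def axis_def vec_eq_iff)
  have "cinner (if i' = i then v else 0) (block X i' k *v (if k = i then v else 0)) =
     (if k = i then if i' = i then cinner v (block X i i *v v) else 0 else 0)" for i' k
    by (simp add: cinner_def)
  then show ?thesis unfolding cinner_block eq by simp
qed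

lemma psd_block: "psd X \<Longrightarrow> psd (block X i i)"
  by (metis cinner_tensor_axis psd_def)

lemma psd_sum: "(\<And>i. i \<in> I \<Longrightarrow> psd (h i)) \<Longrightarrow> psd (\<Sum>i\<in>I. h i)"
proof (induction I rule: infinite_finite_induct)
  case (insert x F) then show ?case by (simp add: psd_add)
qed (simp_all add: psd_def)

lemma psd_ptrace: "psd X \<Longrightarrow> psd (ptrace X)"
  unfolding ptrace_def by (intro psd_sum psd_block)

lemma psd_id_op:
  fixes M :: "complex ^ 'a::finite ^ 'a"
  assumes "psd M" shows "psd (id_op M :: complex ^ ('c::finite \<times> 'a) ^ ('c \<times> 'a))"
proof -
  have "cinner v (id_op M *v v) = (\<Sum>i\<in>UNIV. cinner (\<chi> j. v $ (i, j)) (M *v (\<chi> j. v $ (i, j))))"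
    for v :: "complex ^ ('c \<times> 'a)"
  proof -
    have "cinner v (id_op M *v v) = (\<Sum>i\<in>UNIV. \<Sum>k\<in>UNIV.
        if i = k then cinner (\<chi> j. v $ (i, j)) (M *v (\<chi> j. v $ (k, j))) else 0)"
      unfolding cinner_block block_id_op by (intro sum.cong) auto
    then show ?thesis by simp
  qed
  then show ?thesis
    using assms unfolding psd_def complex_nonneg_Reals_iff by (simp add: sum_nonneg)
qed

lemma psd_id_op_iff: "psd (id_op M) \<longleftrightarrow> psd M"
  using psd_block[of "id_op M"] psd_id_op[of M] by (auto simp: block_id_op)

text \<open>The feasible set of the semidefinite program. Under \<open>choi_of\<close>, positivity
  corresponds to complete positivity and the partial trace condition to trace preservation.\<close>

definition choi :: "complex ^ ('a::finite \<times> 'b::finite) ^ ('a \<times> 'b) \<Rightarrow> bool"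
  where "choi E \<longleftrightarrow> psd E \<and> ptrace E = mat 1"

text \<open>The missing part of the partial trace is spread evenly over A. Since
  \<open>\<rho>\<close> is nonnegative the objective does not drop, so competitors need only satisfy
  an inequality.\<close>

lemma choi_completion:
  fixes \<rho> E :: "complex ^ ('a::finite \<times> 'b::finite) ^ ('a \<times> 'b)"
  assumes \<rho>: "psd \<rho>" and E: "psd E" "psd (mat 1 - ptrace E)"
  shows "\<exists>E'. choi E' \<and> Re (trace (\<rho> ** E)) \<le> Re (trace (\<rho> ** E'))"
proof (intro exI conjI)
  define R :: "complex ^ ('a \<times> 'b) ^ ('a \<times> 'b)"
    where "R = id_op ((1 / real CARD('a)) *\<^sub>R (mat 1 - ptrace E))"
  have R: "psd R" unfolding R_def by (intro psd_id_op psd_scaleR E) simp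
  show "choi (E + R)"
    unfolding choi_def by (simp add: psd_add E R ptrace_add) (simp add: R_def ptrace_id_op)
  show "Re (trace (\<rho> ** E)) \<le> Re (trace (\<rho> ** (E + R)))"
    using psd_trace_mult[OF \<rho> R] by (simp add: matrix_add_ldistrib trace_add complex_nonneg_Reals_iff)
qed

text \<open>A diagonal entry of \<open>E\<close> is one of the nonnegative terms adding up to a
  diagonal entry of \<open>ptrace E\<close>, hence at most 1; the diagonal bounds the rest.\<close>

lemma compact_choi: "compact {E :: complex ^ ('a::finite \<times> 'b::finite) ^ ('a \<times> 'b). choi E}"
  unfolding compact_eq_bounded_closed
proof
  show "bounded {E :: complex ^ ('a \<times> 'b) ^ ('a \<times> 'b). choi E}"
  proof (rule bounded_matrices)
    fix E :: "complex ^ ('a \<times> 'b) ^ ('a \<times> 'b)" and p q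
    assume "E \<in> {E. choi E}"
    then have E: "psd E" "ptrace E = mat 1" by (auto simp: choi_def)
    have diag: "Re (E $ p $ p) \<le> 1" for p
    proof -
      have "Re (ptrace E $ snd p $ snd p) = (\<Sum>i\<in>UNIV. Re (E $ (i, snd p) $ (i, snd p)))"
        by (simp add: ptrace_def block_def)
      moreover have "Re (E $ (fst p, snd p) $ (fst p, snd p)) \<le> \<dots>"
        by (rule member_le_sum) (simp_all add: psd_diag[OF E(1)])
      ultimately show ?thesis by (simp add: E(2) mat_def)
    qed
    show "norm (E $ p $ q) \<le> 1"
      using psd_norm_entry_le[OF E(1), of p q] diag[of p] diag[of q] by simp
  qed
  have eq: "{E :: complex ^ ('a \<times> 'b) ^ ('a \<times> 'b). choi E} =
      {E. (\<forall>v. 0 \<le> Re (cinner v (E *v v)) \<and> Im (cinner v (E *v v)) = 0) \<and>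
        (\<forall>j l. ptrace E $ j $ l = mat 1 $ j $ l)}"
    by (auto simp: choi_def psd_def complex_nonneg_Reals_iff vec_eq_iff)
  show "closed {E :: complex ^ ('a \<times> 'b) ^ ('a \<times> 'b). choi E}"
    unfolding eq ptrace_def block_def cinner_def matrix_vector_mult_def
    by (simp, intro closed_Collect_conj closed_Collect_all closed_Collect_eq closed_Collect_le continuous_intros)
qed

lemma choi_maximum:
  fixes \<rho> :: "complex ^ ('a::finite \<times> 'b::finite) ^ ('a \<times> 'b)"
  shows "\<exists>E. choi E \<and> (\<forall>E'. choi E' \<longrightarrow> Re (trace (\<rho> ** E')) \<le> Re (trace (\<rho> ** E)))"
proof -
  \<comment> \<open>Choi matrix of the completely depolarising channel.\<close>
  have "choi (id_op ((1 / real CARD('a)) *\<^sub>R mat 1) :: complex ^ ('a \<times> 'b) ^ ('a \<times> 'b))"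
    by (simp add: choi_def psd_id_op psd_scaleR psd_mat_1 ptrace_id_op)
  then have ne: "{E :: complex ^ ('a \<times> 'b) ^ ('a \<times> 'b). choi E} \<noteq> {}" by blast
  have cont: "continuous_on {E. choi E} (\<lambda>E. Re (trace (\<rho> ** E)))"
    unfolding trace_def matrix_matrix_mult_def by (simp, intro continuous_intros)
  show ?thesis using continuous_attains_sup[OF compact_choi ne cont] by auto
qed

text \<open>First-order optimality. The competitor comes from \<open>(1 - \<epsilon>g/2) E (1 - \<epsilon>g/2) + \<epsilon> |v><v|\<close>
  with \<open>g = tr\<^sub>A |v><v|\<close>, whose partial trace is \<open>1\<close> up to second order in \<open>\<epsilon>\<close>.\<close>

lemma choi_maximum_dual:
  fixes \<rho> E :: "complex ^ ('a::finite \<times> 'b::finite) ^ ('a \<times> 'b)"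
  assumes \<rho>: "psd \<rho>" and E: "choi E"
    and max: "\<And>E'. choi E' \<Longrightarrow> Re (trace (\<rho> ** E')) \<le> Re (trace (\<rho> ** E))"
  defines "\<sigma> \<equiv> (1 / 2) *\<^sub>R (ptrace (E ** \<rho>) + ptrace (\<rho> ** E))"
  shows "psd (id_op \<sigma> - \<rho>)" "trace \<sigma> = of_real (Re (trace (\<rho> ** E)))"
proof -
  define q where "q = Re (trace (\<rho> ** E))"
  have psdE: "psd E" and trE: "ptrace E = mat 1" using E by (auto simp: choi_def)
  have q0: "0 \<le> q"
    using psd_trace_mult[OF \<rho> psdE] by (simp add: q_def complex_nonneg_Reals_iff)
  have tau: "cadjoint (ptrace (E ** \<rho>)) = ptrace (\<rho> ** E)" "cadjoint (ptrace (\<rho> ** E)) = ptrace (E ** \<rho>)"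
    by (simp_all add: cadjoint_mult psd_cadjoint \<rho> psdE flip: ptrace_cadjoint)
  have sig: "cadjoint \<sigma> = \<sigma>"
    by (simp add: \<sigma>_def cadjoint_scaleR cadjoint_add tau add.commute)
  have "Im (trace (\<rho> ** E)) = 0"
    using psd_trace_mult[OF \<rho> psdE] by (simp add: complex_nonneg_Reals_iff)
  then show "trace \<sigma> = of_real (Re (trace (\<rho> ** E)))"
    by (simp add: \<sigma>_def trace_scaleR trace_add trace_ptrace trace_mul_sym[of E \<rho>] complex_eq_iff)
  show "psd (id_op \<sigma> - \<rho>)"
  proof (rule psdI_cadjoint)
    show "cadjoint (id_op \<sigma> - \<rho>) = id_op \<sigma> - \<rho>"
      by (simp add: cadjoint_diff cadjoint_id_op sig psd_cadjoint \<rho>)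
    fix v :: "complex ^ ('a \<times> 'b)"
    define G where "G = ket_bra v"
    define g where "g = ptrace G"
    have g: "psd g" "cadjoint g = g"
      unfolding g_def G_def by (simp_all add: psd_ptrace psd_ket_bra psd_cadjoint)
    define s where "s = Re (trace (\<sigma> ** g))"
    have s: "Re (trace (\<rho> ** (id_op g ** E))) + Re (trace (\<rho> ** (E ** id_op g))) = 2 * s"
    proof -
      have "trace (\<rho> ** (id_op g ** E)) = trace (id_op g ** (E ** \<rho>))"
        "trace (\<rho> ** (E ** id_op g)) = trace (id_op g ** (\<rho> ** E))"
        by (metis matrix_mul_assoc trace_mul_sym)+
      then show ?thesis
        by (simp add: trace_id_op_mult s_def \<sigma>_def trace_mul_sym[of _ g] matrix_add_ldistrib
            scaleR_mult_right trace_scaleR trace_add)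
    qed
    \<comment> \<open>The square of \<open>g\<close> is the second-order excess of the partial
      trace; \<open>c\<close> bounds it independently of \<open>\<epsilon>\<close>.\<close>
    have "psd (g ** g)" using psd_cadjoint_mult[of g] by (simp add: g)
    then obtain c where c: "0 \<le> c" "psd (c *\<^sub>R mat 1 - g ** g)"
      using psd_le_scaleR_mat_1 by blast
    have var: "Re (trace (\<rho> ** G)) - s \<le> \<epsilon> / 4 * (c * q)" if \<epsilon>: "0 < \<epsilon>" for \<epsilon> :: real
    proof -
      \<comment> \<open>\<open>E1 + \<epsilon> *\<^sub>R G\<close> has partial trace
        \<open>mat 1 + (\<epsilon>\<^sup>2 / 4) *\<^sub>R (g ** g)\<close>, which is at most
        \<open>k *\<^sub>R mat 1\<close>; dividing by \<open>k\<close> makes it completable.\<close>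
      define k where "k = 1 + \<epsilon>\<^sup>2 / 4 * c"
      have k: "1 \<le> k" using c by (simp add: k_def)
      define M where "M = mat 1 - (\<epsilon> / 2) *\<^sub>R g"
      have M: "cadjoint M = M" by (simp add: M_def cadjoint_diff cadjoint_scaleR g)
      define E1 where "E1 = id_op M ** E ** id_op M"
      have E1: "psd E1"
        using psd_conj[OF psdE, of "id_op M"] by (simp add: E1_def cadjoint_id_op M)
      have E1_eq: "E1 = E - (\<epsilon> / 2) *\<^sub>R (id_op g ** E) - (\<epsilon> / 2) *\<^sub>R (E ** id_op g)
          + (\<epsilon>\<^sup>2 / 4) *\<^sub>R (id_op g ** E ** id_op g)"
        by (simp add: E1_def M_def id_op_diff id_op_scaleR id_op_mat_1 matrix_diff_ldistrib
            matrix_diff_rdistrib scaleR_mult_left scaleR_mult_right scaleR_diff_right power2_eq_square)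
      have pE1: "ptrace E1 = mat 1 - \<epsilon> *\<^sub>R g + (\<epsilon>\<^sup>2 / 4) *\<^sub>R (g ** g)"
        by (simp add: E1_def M_def ptrace_mult_id_op ptrace_id_op_mult trE matrix_diff_ldistrib
            matrix_diff_rdistrib scaleR_mult_left scaleR_mult_right scaleR_diff_right power2_eq_square)
          (simp only: mult_2 scaleR_add_right scaleR_add_left[symmetric] field_sum_of_halves)
      define E2 where "E2 = (1 / k) *\<^sub>R (E1 + \<epsilon> *\<^sub>R G)"
      have E2: "psd E2"
        unfolding E2_def G_def using k \<epsilon> by (intro psd_scaleR psd_add E1 psd_ket_bra) auto
      have "mat 1 = (1 / k) *\<^sub>R (k *\<^sub>R (mat 1 :: complex ^ 'b ^ 'b))" using k by simp
      then have "mat 1 - ptrace E2 = (1 / k) *\<^sub>R (k *\<^sub>R mat 1 - (mat 1 + (\<epsilon>\<^sup>2 / 4) *\<^sub>R (g ** g)))"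
        by (simp only: scaleR_diff_right) (simp add: E2_def ptrace_scaleR ptrace_add pE1 g_def)
      also have "\<dots> = (1 / k) *\<^sub>R ((\<epsilon>\<^sup>2 / 4) *\<^sub>R (c *\<^sub>R mat 1 - g ** g))"
        by (simp add: k_def algebra_simps)
      finally have "psd (mat 1 - ptrace E2)"
        using k c by (simp add: psd_scaleR)
      then obtain E3 where "choi E3" "Re (trace (\<rho> ** E2)) \<le> Re (trace (\<rho> ** E3))"
        using choi_completion[OF \<rho> E2] by blast
      then have "Re (trace (\<rho> ** E2)) \<le> q" using max[of E3] by (simp add: q_def)
      moreover have "Re (trace (\<rho> ** E2)) = (Re (trace (\<rho> ** E1)) + \<epsilon> * Re (trace (\<rho> ** G))) / k"
        by (simp add: E2_def scaleR_mult_right trace_scaleR matrix_add_ldistrib trace_add)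
      ultimately have "Re (trace (\<rho> ** E1)) + \<epsilon> * Re (trace (\<rho> ** G)) \<le> k * q"
        using k by (simp add: divide_le_eq mult.commute)
      moreover have "Re (trace (\<rho> ** E1)) = q - \<epsilon> * s
          + \<epsilon>\<^sup>2 / 4 * Re (trace (\<rho> ** (id_op g ** E ** id_op g)))"
      proof -
        have "Re (trace (\<rho> ** E1)) = q - \<epsilon> / 2 * Re (trace (\<rho> ** (id_op g ** E)))
            - \<epsilon> / 2 * Re (trace (\<rho> ** (E ** id_op g)))
            + \<epsilon>\<^sup>2 / 4 * Re (trace (\<rho> ** (id_op g ** E ** id_op g)))"
          by (simp add: E1_eq matrix_add_ldistrib matrix_diff_ldistrib scaleR_mult_right
              trace_add trace_sub trace_scaleR q_def)
        moreover have "\<epsilon> * s = \<epsilon> / 2 * (Re (trace (\<rho> ** (id_op g ** E))) + Re (trace (\<rho> ** (E ** id_op g))))"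
          by (simp only: s)
        ultimately show ?thesis by (simp only: distrib_left)
      qed
      \<comment> \<open>The quadratic term of \<open>E1\<close> helps the competitor and may be
        dropped. The only second-order loss left is \<open>(k - 1) * q\<close>.\<close>
      moreover have "0 \<le> \<epsilon>\<^sup>2 / 4 * Re (trace (\<rho> ** (id_op g ** E ** id_op g)))"
        using psd_trace_mult[OF \<rho> psd_conj[OF psdE, of "id_op g"]]
        by (simp add: cadjoint_id_op g complex_nonneg_Reals_iff)
      ultimately have "\<epsilon> * (Re (trace (\<rho> ** G)) - s) \<le> \<epsilon> * (\<epsilon> / 4 * (c * q))"
        by (simp add: k_def algebra_simps power2_eq_square)
      then show ?thesis using \<epsilon> by (simp only: mult_le_cancel_left_pos)
    qed
    have "Re (trace (\<rho> ** G)) \<le> s"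
    proof (rule ccontr)
      assume "\<not> Re (trace (\<rho> ** G)) \<le> s"
      then have d: "0 < Re (trace (\<rho> ** G)) - s" by simp
      have cq: "0 \<le> c * q" using c q0 by simp
      \<comment> \<open>An explicit \<open>\<epsilon>\<close> replaces the limit: the supposed gap
        divided by \<open>1 + c * q\<close>. The summand 1 keeps the quotient defined when
        \<open>c * q = 0\<close>.\<close>
      have "Re (trace (\<rho> ** G)) - s \<le> (Re (trace (\<rho> ** G)) - s) / (1 + c * q) / 4 * (c * q)"
        using d cq by (intro var divide_pos_pos) auto
      also have "\<dots> = (Re (trace (\<rho> ** G)) - s) * (c * q / (4 * (1 + c * q)))"
        by simp
      also have "\<dots> < (Re (trace (\<rho> ** G)) - s) * 1"
        using cq by (intro mult_strict_left_mono d) (simp add: divide_less_eq)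
      finally show False by simp
    qed
    moreover have "trace (\<rho> ** G) = cinner v (\<rho> *v v)"
      unfolding G_def by (rule trace_ket_bra_mult)
    \<comment> \<open>By adjointness, pairing \<open>\<sigma>\<close> with the marginal
      \<open>g\<close> is pairing \<open>id_op \<sigma>\<close> with
      \<open>ket_bra v\<close>.\<close>
    moreover have "trace (\<sigma> ** g) = cinner v (id_op \<sigma> *v v)"
      unfolding g_def trace_id_op_mult[symmetric] G_def by (rule trace_ket_bra_mult)
    ultimately show "0 \<le> Re (cinner v ((id_op \<sigma> - \<rho>) *v v))"
      by (simp add: s_def matrix_vector_mult_diff_rdistrib cinner_diff_right)
  qed
qed

text \<open>Pair the nonnegative slack with \<open>E\<close>: the condition
  \<open>ptrace E = mat 1\<close> reduces the first term to \<open>trace \<sigma>\<close>.\<close>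

lemma choi_weak_duality:
  assumes "choi E" "psd (id_op \<sigma> - \<rho>)"
  shows "Re (trace (\<rho> ** E)) \<le> Re (trace \<sigma>)"
proof -
  have "0 \<le> Re (trace ((id_op \<sigma> - \<rho>) ** E))"
    using psd_trace_mult[OF assms(2), of E] assms(1) by (simp add: choi_def complex_nonneg_Reals_iff)
  then show ?thesis
    using assms(1) by (simp add: matrix_diff_rdistrib trace_sub trace_id_op_mult choi_def)
qed

subsection \<open>Quantum operations and Choi matrices\<close>

lemma cscale_mult_left: "cscale c A ** B = cscale c (A ** B)"
  by (simp add: cscale_def matrix_matrix_mult_def vec_eq_iff sum_distrib_left mult.assoc)

lemma cscale_mult_right: "A ** cscale c B = cscale c (A ** B)"
  by (simp add: cscale_def matrix_matrix_mult_def vec_eq_iff sum_distrib_left mult_ac)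

lemma cscale_sum: "cscale c (\<Sum>i\<in>I. h i) = (\<Sum>i\<in>I. cscale c (h i))"
  by (simp add: cscale_def vec_eq_iff sum_distrib_left)

lemma cinner_cscale: "cinner v (cscale c A *v w) = c * cinner v (A *v w)"
  by (simp add: cinner_def cscale_def matrix_vector_mult_def sum_distrib_left mult_ac)

lemma cinner_column: "cinner (column i W) (A *v column k W) = (cadjoint W ** A ** W) $ i $ k"
  unfolding mult_axis[symmetric]
  by (subst cinner_cadjoint[of "axis i 1" "cadjoint W", unfolded cadjoint_cadjoint, symmetric])
    (simp only: matrix_vector_mul_assoc cinner_axis matrix_mul_assoc)

lemma trace_sum: "trace (\<Sum>i\<in>I. h i) = (\<Sum>i\<in>I. trace (h i))" for h :: "'i \<Rightarrow> complex ^ 'n ^ 'n"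
  by (simp add: trace_def) (rule sum.swap)

text \<open>Testing the image blocks on \<open>v i\<close> amounts to testing the original blocks on
  \<open>cadjoint (K m) *v v i\<close> and summing over \<open>m\<close>, which works for every
  reference dimension \<open>r\<close>.\<close>

lemma kraus_quantum_operation:
  fixes K :: "'i::finite \<Rightarrow> complex ^ 'n::finite ^ 'k::finite"
  assumes "(\<Sum>m\<in>UNIV. cadjoint (K m) ** K m) = mat 1"
  shows "quantum_operation (\<lambda>Y. \<Sum>m\<in>UNIV. K m ** Y ** cadjoint (K m))" (is "quantum_operation ?F")
  unfolding quantum_operation_def
proof (intro conjI)
  show "Vector_Spaces.linear cscale cscale ?F"
    unfolding linear_cscale_iff
    by (simp add: matrix_add_ldistrib matrix_add_rdistrib sum.distrib cscale_mult_left
        cscale_mult_right cscale_sum)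
  have K: "cinner v (?F Y *v w) = (\<Sum>m\<in>UNIV. cinner (cadjoint (K m) *v v) (Y *v (cadjoint (K m) *v w)))" for v w Y
    unfolding sum_mult_vec cinner_sum_right
    by (intro sum.cong refl) (metis cinner_cadjoint matrix_vector_mul_assoc)
  show "completely_positive ?F"
    unfolding completely_positive_def block_psd_def
  proof (intro allI impI)
    fix r and X :: "nat \<Rightarrow> nat \<Rightarrow> complex ^ 'n ^ 'n" and v :: "nat \<Rightarrow> complex ^ 'k"
    assume X: "\<forall>v. (\<Sum>i<r. \<Sum>k<r. cinner (v i) (X i k *v v k)) \<in> \<real>\<^sub>\<ge>\<^sub>0"
    have "(\<Sum>i<r. \<Sum>k<r. cinner (v i) (?F (X i k) *v v k)) =
        (\<Sum>m\<in>UNIV. \<Sum>i<r. \<Sum>k<r. cinner (cadjoint (K m) *v v i) (X i k *v (cadjoint (K m) *v v k)))"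
      unfolding K by (subst sum.swap[where A = UNIV], subst sum.swap[where A = UNIV]) simp
    then show "(\<Sum>i<r. \<Sum>k<r. cinner (v i) (?F (X i k) *v v k)) \<in> \<real>\<^sub>\<ge>\<^sub>0"
      using X[rule_format, of "\<lambda>i. cadjoint (K _) *v v i"]
      by (simp only: complex_nonneg_Reals_iff Re_sum Im_sum) (simp add: sum_nonneg)
  qed
  show "trace_preserving ?F"
    unfolding trace_preserving_def
  proof
    fix Y
    have "trace (K m ** Y ** cadjoint (K m)) = trace (Y ** (cadjoint (K m) ** K m))" for m
      by (metis matrix_mul_assoc trace_mul_sym)
    then have "trace (?F Y) = trace (Y ** (\<Sum>m\<in>UNIV. cadjoint (K m) ** K m))"
      by (simp only: trace_sum sum_mult_right)
    then show "trace (?F Y) = trace Y" by (simp add: assms)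
  qed
qed

section \<open>Passage between quantum operations and Choi matrices\<close>

definition matrix_unit :: "'n \<Rightarrow> 'n \<Rightarrow> complex ^ 'n::finite ^ 'n"
  where "matrix_unit j l = (\<chi> r s. if r = j \<and> s = l then 1 else 0)"

lemma linear_matrix_unit_expansion:
  fixes F :: "complex ^ 'n::finite ^ 'n \<Rightarrow> complex ^ 'k ^ 'k"
  assumes "Vector_Spaces.linear cscale cscale F"
  shows "F Y = (\<Sum>j\<in>UNIV. \<Sum>l\<in>UNIV. cscale (Y $ j $ l) (F (matrix_unit j l)))"
proof -
  have add: "F (A + B) = F A + F B" and sc: "F (cscale c A) = cscale c (F A)" for A B c
    using assms by (auto simp: linear_cscale_iff)
  have "F 0 = 0" using add[of 0 0] by simp
  then have sum: "F (\<Sum>i\<in>I. h i) = (\<Sum>i\<in>I. F (h i))" for I and h :: "'n \<Rightarrow> _"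
    by (induction I rule: infinite_finite_induct) (auto simp: add)
  have "(\<Sum>j\<in>UNIV. \<Sum>l\<in>UNIV. cscale (Y $ j $ l) (matrix_unit j l)) $ r $ s = Y $ r $ s" for r s
  proof -
    have "cscale (Y $ j $ l) (matrix_unit j l) $ r $ s = (if s = l then if r = j then Y $ j $ l else 0 else 0)" for j l
      by (simp add: cscale_def matrix_unit_def)
    then have "(\<Sum>j\<in>UNIV. \<Sum>l\<in>UNIV. cscale (Y $ j $ l) (matrix_unit j l)) $ r $ s =
       (\<Sum>j\<in>UNIV. \<Sum>l\<in>UNIV. if s = l then if r = j then Y $ j $ l else 0 else 0)"
      by (simp only: sum_component)
    then show ?thesis by simp
  qed
  then have "F Y = F (\<Sum>j\<in>UNIV. \<Sum>l\<in>UNIV. cscale (Y $ j $ l) (matrix_unit j l))"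
    by (intro arg_cong[of _ _ F]) (simp add: vec_eq_iff)
  then show ?thesis by (simp only: sum sc)
qed

text \<open>The Choi matrix of \<open>F\<close>, written in the columns of \<open>W\<close> and with both factors transposed,
  so that no transpose appears in \<open>tr (\<rho> E)\<close>.\<close>

definition choi_of ::
    "complex ^ 'a ^ 'c \<Rightarrow> (complex ^ 'b::finite ^ 'b \<Rightarrow> complex ^ 'c::finite ^ 'c) \<Rightarrow> complex ^ ('a::finite \<times> 'b) ^ ('a \<times> 'b)"
  where "choi_of W F = (\<chi> p q. cinner (column (fst q) W)
    (F (matrix_unit (snd q) (snd p)) *v column (fst p) W))"

lemma trace_mult_prod:
  "trace (X ** Y) = (\<Sum>i\<in>UNIV. \<Sum>k\<in>UNIV. \<Sum>j\<in>UNIV. \<Sum>l\<in>UNIV. X $ (i, j) $ (k, l) * Y $ (k, l) $ (i, j))"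
  for X Y :: "complex ^ ('a::finite \<times> 'b::finite) ^ ('a \<times> 'b)"
  by (simp add: trace_def matrix_matrix_mult_def sum_UNIV_prod) (intro sum.cong refl sum.swap)

text \<open>For \<open>W = basis_change e f\<close> the right side is the rescaled expectation in
  the maximally entangled vector (\<open>cinner_max_entangled\<close>), so the objective becomes
  linear in the Choi matrix.\<close>

lemma choi_of_trace:
  assumes "Vector_Spaces.linear cscale cscale F"
  shows "trace (\<rho> ** choi_of W F) =
    (\<Sum>i\<in>UNIV. \<Sum>k\<in>UNIV. cinner (column i W) (F (block \<rho> i k) *v column k W))"
  unfolding trace_mult_prod
proof (intro sum.cong refl)
  fix i k
  show "(\<Sum>j\<in>UNIV. \<Sum>l\<in>UNIV. \<rho> $ (i, j) $ (k, l) * choi_of W F $ (k, l) $ (i, j)) =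
    cinner (column i W) (F (block \<rho> i k) *v column k W)"
    by (subst linear_matrix_unit_expansion[OF assms])
      (simp add: sum_mult_vec cinner_sum_right cinner_cscale choi_of_def block_def)
qed

text \<open>Positivity is complete positivity tested with a reference copy of B. In the partial
  trace, \<open>W ** cadjoint W = mat 1\<close> removes \<open>W\<close> by cyclicity and leaves
  \<open>trace (F (matrix_unit j l))\<close>.\<close>

lemma choi_choi_of:
  fixes F :: "complex ^ 'b::finite ^ 'b \<Rightarrow> complex ^ 'c::finite ^ 'c"
    and W :: "complex ^ 'a::finite ^ 'c"
  assumes F: "quantum_operation F" and W: "W ** cadjoint W = mat 1"
  shows "choi (choi_of W F)"
  unfolding choi_def
proof
  \<comment> \<open>The unnormalised maximally entangled state of two copies of B; its blocks are
    the matrix units.\<close>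
  define X :: "complex ^ ('b \<times> 'b) ^ ('b \<times> 'b)"
    where "X = ket_bra (\<chi> p. if fst p = snd p then 1 else 0)"
  have bX: "block X j l = matrix_unit j l" for j l
    by (auto simp: X_def block_def matrix_unit_def ket_bra_def vec_eq_iff)
  have pX: "psd (id_tensor F X)"
    using F by (intro completely_positive_imp_psd) (auto simp: quantum_operation_def X_def psd_ket_bra)
  show "psd (choi_of W F)"
    unfolding psd_def
  proof
    fix v :: "complex ^ ('a \<times> 'b)"
    \<comment> \<open>The components of \<open>v\<close> are conjugated because
      \<open>choi_of\<close> is transposed; the form of \<open>choi_of W F\<close> at
      \<open>v\<close> is then that of \<open>id_tensor F X\<close> at \<open>u'\<close>.\<close>
    define u where "u j = (\<Sum>i\<in>UNIV. cnj (v $ (i, j)) *s column i W)" for j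
    define u' :: "complex ^ ('b \<times> 'c)" where "u' = (\<chi> p. u (fst p) $ snd p)"
    have u': "(\<chi> j. u' $ (i, j)) = u i" for i by (simp add: u'_def vec_eq_iff)
    define h where "h i j k l = v $ (i, j) * cnj (v $ (k, l)) *
       cinner (column i W) (F (matrix_unit j l) *v column k W)" for i j k l
    have "cinner v (choi_of W F *v v) = (\<Sum>k\<in>UNIV. \<Sum>l\<in>UNIV. \<Sum>i\<in>UNIV. \<Sum>j\<in>UNIV. h i j k l)"
      unfolding cinner_def[of v] matrix_vector_mult_def[of "choi_of W F"]
      by (simp add: sum_UNIV_prod sum_distrib_left choi_of_def h_def mult_ac)
    also have "\<dots> = (\<Sum>l\<in>UNIV. \<Sum>k\<in>UNIV. \<Sum>j\<in>UNIV. \<Sum>i\<in>UNIV. h i j k l)"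
      by (subst sum.swap) (intro sum.cong refl sum.swap)
    also have "\<dots> = (\<Sum>l\<in>UNIV. \<Sum>j\<in>UNIV. \<Sum>k\<in>UNIV. \<Sum>i\<in>UNIV. h i j k l)"
      by (intro sum.cong refl sum.swap)
    also have "\<dots> = (\<Sum>j\<in>UNIV. \<Sum>l\<in>UNIV. \<Sum>i\<in>UNIV. \<Sum>k\<in>UNIV. h i j k l)"
      by (subst sum.swap) (intro sum.cong refl sum.swap)
    also have "\<dots> = (\<Sum>j\<in>UNIV. \<Sum>l\<in>UNIV. cinner (u j) (F (matrix_unit j l) *v u l))"
      by (intro sum.cong refl)
        (simp add: u_def h_def cinner_sum_left cinner_scale_left vec.linear_sum[OF matrix_vector_mul_linear_gen]
          vector_scalar_commute cinner_sum_right cinner_scale_right sum_distrib_left mult_ac, rule sum.swap)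
    also have "\<dots> = cinner u' (id_tensor F X *v u')"
      unfolding cinner_block block_id_tensor u' bX by simp
    finally show "cinner v (choi_of W F *v v) \<in> \<real>\<^sub>\<ge>\<^sub>0"
      using pX by (simp add: psd_def)
  qed
  have "ptrace (choi_of W F) $ l $ j = mat 1 $ l $ j" for l j
  proof -
    have "ptrace (choi_of W F) $ l $ j = trace (cadjoint W ** F (matrix_unit j l) ** W)"
      by (simp add: ptrace_def block_def choi_of_def cinner_column trace_def)
    also have "\<dots> = trace (F (matrix_unit j l) ** (W ** cadjoint W))"
      by (metis matrix_mul_assoc trace_mul_sym)
    also have "\<dots> = trace (matrix_unit j l)"
      using F by (simp add: W quantum_operation_def trace_preserving_def)
    also have "\<dots> = (\<Sum>r\<in>UNIV. if r = j then if j = l then 1 else 0 else 0)"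
      unfolding trace_def matrix_unit_def by (intro sum.cong) auto
    finally show ?thesis by (simp add: mat_def)
  qed
  then show "ptrace (choi_of W F) = mat 1" by (simp add: vec_eq_iff)
qed

text \<open>A factor \<open>C\<close> of \<open>E\<close> supplies Kraus operators: each row,
  reshaped into a matrix \<open>D m\<close> from B to A, is followed by the isometry
  \<open>W\<close> into A'. Their completeness relation is exactly
  \<open>ptrace E = mat 1\<close>.\<close>

lemma choi_realisation:
  fixes E \<rho> :: "complex ^ ('a::finite \<times> 'b::finite) ^ ('a \<times> 'b)" and W :: "complex ^ 'a ^ 'c::finite"
  assumes E: "choi E" and W: "cadjoint W ** W = mat 1"
  shows "\<exists>F. quantum_operation F \<and> trace (\<rho> ** E) =
    (\<Sum>i\<in>UNIV. \<Sum>k\<in>UNIV. cinner (column i W) (F (block \<rho> i k) *v column k W))"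
proof -
  obtain C :: "complex ^ ('a \<times> 'b) ^ ('a \<times> 'b)" where C: "E = cadjoint C ** C"
    using E psd_imp_cadjoint_mult unfolding choi_def by blast
  define D :: "'a \<times> 'b \<Rightarrow> complex ^ 'b ^ 'a" where "D m = (\<chi> i j. C $ m $ (i, j))" for m
  define F where "F Y = (\<Sum>m\<in>UNIV. (W ** D m) ** Y ** cadjoint (W ** D m))" for Y
  have "cadjoint (W ** D m) ** (W ** D m) = cadjoint (D m) ** (cadjoint W ** W) ** D m" for m
    by (simp add: cadjoint_mult matrix_mul_assoc)
  then have WD: "cadjoint (W ** D m) ** (W ** D m) = cadjoint (D m) ** D m" for m
    by (simp add: W)
  have "(\<Sum>m\<in>UNIV. cadjoint (D m) ** D m) = ptrace E"
    by (simp add: vec_eq_iff ptrace_def block_def C D_def cadjoint_def matrix_matrix_mult_def) (intro allI sum.swap)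
  then have F: "quantum_operation F"
    using E unfolding F_def by (intro kraus_quantum_operation) (simp add: WD choi_def)
  have "cadjoint W ** F Y ** W = (\<Sum>m\<in>UNIV. D m ** Y ** cadjoint (D m))" for Y
  proof -
    have "cadjoint W ** ((W ** D m) ** Y ** cadjoint (W ** D m)) ** W =
        (cadjoint W ** W) ** (D m ** Y ** cadjoint (D m)) ** (cadjoint W ** W)" for m
      by (simp add: cadjoint_mult matrix_mul_assoc)
    then show ?thesis by (simp add: F_def sum_mult_right sum_mult_left W)
  qed
  then have ent: "cinner (column i W) (F Y *v column k W) =
      (\<Sum>m\<in>UNIV. \<Sum>l\<in>UNIV. \<Sum>j\<in>UNIV. C $ m $ (i, j) * Y $ j $ l * cnj (C $ m $ (k, l)))" for i k Y
    by (simp add: cinner_column D_def cadjoint_def matrix_matrix_mult_def sum_distrib_right)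
  have "trace (\<rho> ** E) =
    (\<Sum>i\<in>UNIV. \<Sum>k\<in>UNIV. cinner (column i W) (F (block \<rho> i k) *v column k W))"
    unfolding trace_mult_prod
  proof (intro sum.cong refl)
    fix i k
    define h where "h m j l = C $ m $ (i, j) * \<rho> $ (i, j) $ (k, l) * cnj (C $ m $ (k, l))" for m j l
    have "(\<Sum>j\<in>UNIV. \<Sum>l\<in>UNIV. \<rho> $ (i, j) $ (k, l) * E $ (k, l) $ (i, j)) =
      (\<Sum>j\<in>UNIV. \<Sum>l\<in>UNIV. \<Sum>m\<in>UNIV. h m j l)"
      by (simp add: C cadjoint_def matrix_matrix_mult_def sum_distrib_left h_def mult_ac)
    also have "\<dots> = (\<Sum>j\<in>UNIV. \<Sum>m\<in>UNIV. \<Sum>l\<in>UNIV. h m j l)"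
      by (intro sum.cong refl sum.swap)
    also have "\<dots> = (\<Sum>m\<in>UNIV. \<Sum>l\<in>UNIV. \<Sum>j\<in>UNIV. h m j l)"
      by (subst sum.swap) (intro sum.cong refl sum.swap)
    finally show "(\<Sum>j\<in>UNIV. \<Sum>l\<in>UNIV. \<rho> $ (i, j) $ (k, l) * E $ (k, l) $ (i, j)) =
      cinner (column i W) (F (block \<rho> i k) *v column k W)"
      by (simp add: ent block_def h_def)
  qed
  then show ?thesis using F by blast
qed

section \<open>Orthonormal bases and the maximally entangled vector\<close>

lemma orthonormal_basis_expansion:
  fixes e :: "nat \<Rightarrow> complex ^ 'n::finite"
  assumes "orthonormal_basis e"
  shows "v = (\<Sum>x=1..CARD('n). cinner (e x) v *s e x)"
proof -
  have "v \<in> vec.span (e ` {1..CARD('n)})"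
    using assms by (simp add: orthonormal_basis_def)
  then show ?thesis
  proof (induction rule: vec.span_induct_alt)
    case base
    show ?case by (simp add: vec_eq_iff)
  next
    case (step c w y)
    then obtain z where z: "z \<in> {1..CARD('n)}" "w = e z" by auto
    have "(\<Sum>x=1..CARD('n). cinner (e x) w *s e x) = (\<Sum>x=1..CARD('n). if x = z then e x else 0)"
      using assms z by (intro sum.cong) (auto simp: orthonormal_basis_def)
    then have w: "(\<Sum>x=1..CARD('n). cinner (e x) w *s e x) = w"
      using z by simp
    have "(\<Sum>x=1..CARD('n). cinner (e x) (c *s w + y) *s e x) =
      c *s (\<Sum>x=1..CARD('n). cinner (e x) w *s e x) + (\<Sum>x=1..CARD('n). cinner (e x) y *s e x)"
      by (simp add: cinner_add_right cinner_scale_right vec.scale_left_distrib sum.distrib vec.scale_sum_right)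
    then show ?case using w step.IH by metis
  qed
qed

text \<open>Resolution of the identity, read off from the expansion of a standard basis
  vector.\<close>

lemma orthonormal_basis_complete:
  fixes e :: "nat \<Rightarrow> complex ^ 'n::finite"
  assumes "orthonormal_basis e"
  shows "(\<Sum>x=1..CARD('n). cnj (e x $ i) * e x $ k) = (if i = k then 1 else 0)"
proof -
  have ax: "cinner (e x) (axis i 1) = cnj (e x $ i)" for x
    by (subst cinner_commute) (simp add: cinner_axis_left)
  have "axis i 1 $ k = (\<Sum>x=1..CARD('n). cinner (e x) (axis i 1) *s e x) $ k"
    by (rule arg_cong[OF orthonormal_basis_expansion[OF assms]])
  then show ?thesis unfolding ax by (auto simp: axis_def)
qed

text \<open>The coefficients of the unnormalised maximally entangled vector, reshaped into a matrix.
  For orthonormal bases of equal size it is the unitary sending the complex conjugate of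
  \<open>e x\<close> to \<open>f x\<close>. Its columns are the partners in A' of the standard basis
  of A, which indexes the blocks.\<close>

definition basis_change ::
    "(nat \<Rightarrow> complex ^ 'a::finite) \<Rightarrow> (nat \<Rightarrow> complex ^ 'c::finite) \<Rightarrow> complex ^ 'a ^ 'c"
  where "basis_change e f = (\<chi> j i. \<Sum>x=1..CARD('a). e x $ i * f x $ j)"

lemma basis_change_isometry:
  fixes e :: "nat \<Rightarrow> complex ^ 'a::finite" and f :: "nat \<Rightarrow> complex ^ 'c::finite"
  assumes e: "orthonormal_basis e" and f: "orthonormal_basis f" and d: "CARD('c) = CARD('a)"
  shows "cadjoint (basis_change e f) ** basis_change e f = mat 1"
proof -
  have "(cadjoint (basis_change e f) ** basis_change e f) $ i $ k = mat 1 $ i $ k" for i k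
  proof -
    let ?S = "{1..CARD('a)}"
    have col: "column i (basis_change e f) = (\<Sum>x\<in>?S. e x $ i *s f x)" for i
      by (simp add: column_def basis_change_def vec_eq_iff)
    have "(cadjoint (basis_change e f) ** basis_change e f) $ i $ k =
        cinner (column i (basis_change e f)) (column k (basis_change e f))"
      using cinner_column[of i "basis_change e f" "mat 1" k] by simp
    also have "\<dots> = (\<Sum>y\<in>?S. \<Sum>x\<in>?S. cnj (e x $ i) * e y $ k * cinner (f x) (f y))"
      by (simp add: col cinner_sum_left cinner_sum_right cinner_scale_left cinner_scale_right
          sum_distrib_left mult_ac)
    also have "\<dots> = (\<Sum>y\<in>?S. \<Sum>x\<in>?S. if x = y then cnj (e x $ i) * e y $ k else 0)"
      using f d by (intro sum.cong) (auto simp: orthonormal_basis_def)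
    also have "\<dots> = (\<Sum>y\<in>?S. cnj (e y $ i) * e y $ k)" by simp
    finally show ?thesis
      unfolding orthonormal_basis_complete[OF e] by (simp add: mat_def)
  qed
  then show ?thesis by (simp add: vec_eq_iff)
qed

text \<open>Exchanging the two bases transposes the matrix, so this is the isometry property for the
  exchanged bases.\<close>

lemma basis_change_coisometry:
  fixes e :: "nat \<Rightarrow> complex ^ 'a::finite" and f :: "nat \<Rightarrow> complex ^ 'c::finite"
  assumes "orthonormal_basis e" "orthonormal_basis f" and d: "CARD('c) = CARD('a)"
  shows "basis_change e f ** cadjoint (basis_change e f) = mat 1"
proof -
  have "(basis_change e f ** cadjoint (basis_change e f)) $ j $ l =
      (cadjoint (basis_change f e) ** basis_change f e) $ l $ j" for j l
    by (simp add: basis_change_def cadjoint_def matrix_matrix_mult_def d mult_ac)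
  then show ?thesis
    using basis_change_isometry[OF assms(2,1) d[symmetric]] by (simp add: vec_eq_iff mat_def)
qed

lemma max_entangled_component:
  fixes e :: "nat \<Rightarrow> complex ^ 'a::finite" and f :: "nat \<Rightarrow> complex ^ 'c::finite"
  shows "(\<chi> j. max_entangled e f $ (i, j)) = (1 / sqrt (real CARD('a))) *\<^sub>R column i (basis_change e f)"
  by (simp add: max_entangled_def tensor_vec_def column_def basis_change_def vec_eq_iff)

text \<open>The prefactor \<open>d_A\<close> of \<open>q_corr\<close> cancels the two normalisations
  \<open>1 / sqrt d_A\<close> of the vector.\<close>

lemma cinner_max_entangled:
  fixes e :: "nat \<Rightarrow> complex ^ 'a::finite" and f :: "nat \<Rightarrow> complex ^ 'c::finite"
  shows "of_nat CARD('a) * cinner (max_entangled e f) (X *v max_entangled e f) =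
    (\<Sum>i\<in>UNIV. \<Sum>k\<in>UNIV. cinner (column i (basis_change e f)) (block X i k *v column k (basis_change e f)))"
proof -
  let ?d = "real CARD('a)"
  have mv: "A *v (c *\<^sub>R x) = c *\<^sub>R (A *v x)" for A :: "complex ^ 'c ^ 'c" and c x
    by (simp add: matrix_vector_mult_def vec_eq_iff scaleR_sum_right)
  have "cinner (max_entangled e f) (X *v max_entangled e f) =
     of_real (1 / sqrt ?d) * (of_real (1 / sqrt ?d) *
    (\<Sum>i\<in>UNIV. \<Sum>k\<in>UNIV. cinner (column i (basis_change e f)) (block X i k *v column k (basis_change e f))))"
    unfolding cinner_block max_entangled_component mv cinner_scaleR_left cinner_scaleR_right
    by (simp only: sum_distrib_left)
  note eq = this
  have "(of_nat CARD('a) :: complex) * (of_real (1 / sqrt ?d) * (of_real (1 / sqrt ?d) * z)) = z" for z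
  proof -
    have "(of_nat CARD('a) :: complex) * (of_real (1 / sqrt ?d) * (of_real (1 / sqrt ?d) * z)) =
       of_real (?d * (1 / sqrt ?d) * (1 / sqrt ?d)) * z"
      by (simp only: of_real_mult of_real_of_nat_eq mult.assoc)
    also have "?d * (1 / sqrt ?d) * (1 / sqrt ?d) = 1" by simp
    finally show ?thesis by simp
  qed
  then show ?thesis unfolding eq .
qed

subsection \<open>The operational meaning of the min-entropy\<close>

theorem theorem2:
  fixes \<rho> :: "complex ^ ('a::finite \<times> 'b::finite) ^ ('a \<times> 'b)"
    and e :: "nat \<Rightarrow> complex ^ 'a"
    and f :: "nat \<Rightarrow> complex ^ 'c::finite"
  assumes "density_operator \<rho>"
    and "CARD('c) = CARD('a)"
    and "orthonormal_basis e"
    and "orthonormal_basis f"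
  shows "(\<exists>F. is_arg_max (sq_fidelity_after e f \<rho>) quantum_operation F) \<and>
    0 < q_corr e f \<rho> \<and>
    min_entropy \<rho> = ereal (- log 2 (q_corr e f \<rho>))"
proof -
  let ?W = "basis_change e f" and ?d = "real CARD('a)"
  have psd\<rho>: "psd \<rho>" and tr\<rho>: "trace \<rho> = 1"
    using assms(1) by (auto simp: density_operator_def)
  have W: "cadjoint ?W ** ?W = mat 1" "?W ** cadjoint ?W = mat 1"
    using basis_change_isometry basis_change_coisometry assms by blast+
  have unit: "cinner (max_entangled e f) (max_entangled e f) = 1"
  proof -
    have col: "cinner (column i ?W) (column k ?W) = mat 1 $ i $ k" for i k
      using cinner_column[of i ?W "mat 1" k] W(1) by simp
    have "cinner (column i ?W) (block (mat 1) i k *v column k ?W) = (if k = i then 1 else 0)" for i k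
      unfolding id_op_mat_1[symmetric] block_id_op by (simp add: col) (simp add: mat_def)
    \<comment> \<open>For the identity operator only the diagonal blocks survive, each contributing
      the squared norm 1 of a column of \<open>?W\<close>.\<close>
    then have "of_nat CARD('a) * cinner (max_entangled e f) (max_entangled e f) = of_nat CARD('a)"
      using cinner_max_entangled[of e f "mat 1"] by simp
    then show ?thesis by simp
  qed
  have fid: "?d * sq_fidelity_after e f \<rho> F =
      Re (\<Sum>i\<in>UNIV. \<Sum>k\<in>UNIV. cinner (column i ?W) (F (block \<rho> i k) *v column k ?W))"
    if F: "quantum_operation F" for F
  proof -
    have "psd (id_tensor F \<rho>)"
      using F psd\<rho> by (intro completely_positive_imp_psd) (auto simp: quantum_operation_def)
    then have "sq_fidelity_after e f \<rho> F =
        Re (cinner (max_entangled e f) (id_tensor F \<rho> *v max_entangled e f))"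
      unfolding sq_fidelity_after_def using unit by (rule fidelity_pure)
    then have "?d * sq_fidelity_after e f \<rho> F =
        Re (of_nat CARD('a) * cinner (max_entangled e f) (id_tensor F \<rho> *v max_entangled e f))"
      by simp
    then show ?thesis unfolding cinner_max_entangled block_id_tensor .
  qed
  obtain E where E: "choi E" and max: "\<And>E'. choi E' \<Longrightarrow> Re (trace (\<rho> ** E')) \<le> Re (trace (\<rho> ** E))"
    using choi_maximum by blast
  define q where "q = Re (trace (\<rho> ** E))"
  obtain F where F: "quantum_operation F" and "trace (\<rho> ** E) =
      (\<Sum>i\<in>UNIV. \<Sum>k\<in>UNIV. cinner (column i ?W) (F (block \<rho> i k) *v column k ?W))"
    using choi_realisation[OF E W(1)] by blast
  then have F_q: "?d * sq_fidelity_after e f \<rho> F = q"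
    by (simp only: fid q_def)
  have F_max: "sq_fidelity_after e f \<rho> F' \<le> sq_fidelity_after e f \<rho> F" if F': "quantum_operation F'" for F'
  proof -
    have "?d * sq_fidelity_after e f \<rho> F' = Re (trace (\<rho> ** choi_of ?W F'))"
      using F' by (simp add: fid choi_of_trace quantum_operation_def)
    also have "\<dots> \<le> ?d * sq_fidelity_after e f \<rho> F"
      unfolding F_q q_def by (rule max[OF choi_choi_of[OF F' W(2)]])
    finally show ?thesis by simp
  qed
  have "(SUP F\<in>{F. quantum_operation F}. sq_fidelity_after e f \<rho> F) = sq_fidelity_after e f \<rho> F"
    using F F_max by (intro cSup_eq_maximum) auto
  then have q: "q_corr e f \<rho> = q" by (simp add: q_corr_def F_q)
  \<comment> \<open>The depolarising channel already achieves \<open>1 / ?d\<close>, so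
    \<open>q\<close> is positive; this permits normalising \<open>\<sigma>\<close> and taking the
    logarithm.\<close>
  have "Re (trace (\<rho> ** id_op ((1 / ?d) *\<^sub>R mat 1))) = 1 / ?d"
    by (simp add: id_op_scaleR id_op_mat_1 scaleR_mult_right trace_scaleR tr\<rho>)
  moreover have "choi (id_op ((1 / ?d) *\<^sub>R mat 1) :: complex ^ ('a \<times> 'b) ^ ('a \<times> 'b))"
    by (simp add: choi_def psd_id_op psd_scaleR psd_mat_1 ptrace_id_op)
  ultimately have "1 / ?d \<le> q" using max unfolding q_def by metis
  then have q_pos: "0 < q" by (rule less_le_trans[rotated]) simp
  obtain \<sigma> where \<sigma>: "psd (id_op \<sigma> - \<rho>)" "trace \<sigma> = of_real q"
    using choi_maximum_dual[OF psd\<rho> E max] unfolding q_def by blast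
  \<comment> \<open>\<open>id_op \<sigma>\<close> is the sum of the nonnegative slack and
    \<open>\<rho>\<close>.\<close>
  have "psd (id_op \<sigma> :: complex ^ ('a \<times> 'b) ^ ('a \<times> 'b))"
    using psd_add[OF \<sigma>(1) psd\<rho>] by simp
  then have "psd \<sigma>" by (simp add: psd_id_op_iff)
  then have dens: "density_operator ((1 / q) *\<^sub>R \<sigma>)"
    using q_pos by (simp add: density_operator_def psd_scaleR trace_scaleR \<sigma>)
  have "(INF \<tau>\<in>{\<tau> :: complex ^ 'b ^ 'b. density_operator \<tau>}. D_infinity \<rho> (id_op \<tau>)) = ereal (log 2 q)"
  proof (rule antisym)
    \<comment> \<open>The scalar \<open>2 powr log 2 q = q\<close> undoes the normalisation of
      \<open>\<sigma>\<close>.\<close>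
    have "loewner_le \<rho> ((2 powr log 2 q) *\<^sub>R id_op ((1 / q) *\<^sub>R \<sigma>))"
      using q_pos \<sigma>(1) by (simp add: loewner_le_def id_op_scaleR)
    then have "D_infinity \<rho> (id_op ((1 / q) *\<^sub>R \<sigma>)) \<le> ereal (log 2 q)"
      unfolding D_infinity_def by (intro Inf_lower) blast
    then show "(INF \<tau>\<in>{\<tau> :: complex ^ 'b ^ 'b. density_operator \<tau>}. D_infinity \<rho> (id_op \<tau>)) \<le> ereal (log 2 q)"
      using dens by (intro INF_lower2) auto
  next
    have "log 2 q \<le> l" if "density_operator \<tau>" "loewner_le \<rho> ((2 powr l) *\<^sub>R id_op \<tau>)"
      for \<tau> :: "complex ^ 'b ^ 'b" and l
    proof -
      \<comment> \<open>The scale is moved into the operator on B: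
        \<open>(2 powr l) *\<^sub>R \<tau>\<close> is dual feasible with trace
        \<open>2 powr l\<close>.\<close>
      have "psd (id_op ((2 powr l) *\<^sub>R \<tau>) - \<rho>)"
        using that(2) by (simp add: loewner_le_def id_op_scaleR)
      then have "q \<le> Re (trace ((2 powr l) *\<^sub>R \<tau>))"
        unfolding q_def by (rule choi_weak_duality[OF E])
      also have "\<dots> = 2 powr l"
        using that(1) by (simp add: trace_scaleR density_operator_def)
      finally show ?thesis using q_pos by (simp add: log_le_iff)
    qed
    then show "ereal (log 2 q) \<le> (INF \<tau>\<in>{\<tau> :: complex ^ 'b ^ 'b. density_operator \<tau>}. D_infinity \<rho> (id_op \<tau>))"
      by (auto simp: D_infinity_def intro!: INF_greatest Inf_greatest)
  qed
  then have "min_entropy \<rho> = ereal (- log 2 q)"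
    by (simp add: min_entropy_def)
  moreover have "is_arg_max (sq_fidelity_after e f \<rho>) quantum_operation F"
    using F F_max by (auto simp: is_arg_max_def not_less)
  ultimately show ?thesis using q q_pos by auto
qed

end
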